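(* Let $2<\alpha<Q$. Then for every $r>0$ and every $\phi\in C_0^\infty(B_r)$, $$\int_{B_r}\rho^{\alpha}\frac{|\Delta_\gamma\phi|^2}{|\nabla_\gamma\rho|^2}\,dz\ \ge\ \frac{(Q-\alpha)^2}{4}\int_{B_r}\rho^{\alpha}\frac{|\nabla_\gamma\phi|^2}{\rho^2}\,dz+\frac{(Q-\alpha)(Q+3\alpha-8)}{16}\int_{B_r}\rho^{\alpha-4}|\nabla_\gamma\rho|^2\frac{\phi^2}{\big(\ln\frac{r}{\rho}\big)^2}\,dz .$$
   Context: Points of $\mathbb{R}^n$ are written $z=(x,y)$ with $x\in\mathbb{R}^m$, $y\in\mathbb{R}^k$, $m,k\ge1$, $n=m+k$, and $\gamma>0$. The Baouendi–Grushin gradient is $\nabla_\gamma=(\partial_{x_1},\dots,\partial_{x_m},|x|^\gamma\partial_{y_1},\dots,|x|^\gamma\partial_{y_k})$, and the Baouendi–Grushin operator is $\Delta_\gamma=\nabla_\gamma\cdot\nabla_\gamma=\Delta_x+|x|^{2\gamma}\Delta_y$. The homogeneous dimension is $Q=m+(1+\gamma)k$. The gauge is $\rho(z)=\big(|x|^{2(1+\gamma)}+(1+\gamma)^2|y|^2\big)^{\frac{1}{2(1+\gamma)}}$; one has $|\nabla_\gamma\rho|=|x|^\gamma/\rho^\gamma$. For $r>0$, $B_r=\{z\in\mathbb{R}^n:\rho(z)<r\}$. The integral on the left-hand side is allowed to be $+\infty$. *)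

theory Defs
  imports "HOL-Analysis.Analysis"
begin

fun Ck :: "nat \<Rightarrow> ('a::real_normed_vector \<Rightarrow> real) \<Rightarrow> bool" where
  "Ck 0 f = continuous_on UNIV f"
| "Ck (Suc n) f = ((\<forall>z. f differentiable (at z)) \<and>
      (\<forall>v. Ck n (\<lambda>z. frechet_derivative f (at z) v)))"

definition smooth_fun :: "('a::real_normed_vector \<Rightarrow> real) \<Rightarrow> bool" where
  "smooth_fun f \<longleftrightarrow> (\<forall>n. Ck n f)"

definition C0_infty :: "'a::real_normed_vector set \<Rightarrow> ('a \<Rightarrow> real) set" where
  "C0_infty U = {f. smooth_fun f \<and> compact (closure {z. f z \<noteq> 0}) \<and> closure {z. f z \<noteq> 0} \<subseteq> U}"

definition dx :: "'m::finite \<Rightarrow> ((real^'m) \<times> (real^'k::finite) \<Rightarrow> real) \<Rightarrow> (real^'m) \<times> (real^'k) \<Rightarrow> real" where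
  "dx i f z = frechet_derivative f (at z) (axis i 1, 0)"

definition dy :: "'k::finite \<Rightarrow> ((real^'m::finite) \<times> (real^'k) \<Rightarrow> real) \<Rightarrow> (real^'m) \<times> (real^'k) \<Rightarrow> real" where
  "dy j f z = frechet_derivative f (at z) (0, axis j 1)"

definition grad_sq :: "real \<Rightarrow> ((real^'m::finite) \<times> (real^'k::finite) \<Rightarrow> real) \<Rightarrow> (real^'m) \<times> (real^'k) \<Rightarrow> real" where
  "grad_sq \<gamma> f z = (\<Sum>i\<in>UNIV. (dx i f z)\<^sup>2) + norm (fst z) powr (2*\<gamma>) * (\<Sum>j\<in>UNIV. (dy j f z)\<^sup>2)"

definition grushin :: "real \<Rightarrow> ((real^'m::finite) \<times> (real^'k::finite) \<Rightarrow> real) \<Rightarrow> (real^'m) \<times> (real^'k) \<Rightarrow> real" where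
  "grushin \<gamma> f z = (\<Sum>i\<in>UNIV. dx i (dx i f) z) + norm (fst z) powr (2*\<gamma>) * (\<Sum>j\<in>UNIV. dy j (dy j f) z)"

definition gauge :: "real \<Rightarrow> (real^'m::finite) \<times> (real^'k::finite) \<Rightarrow> real" where
  "gauge \<gamma> z = (norm (fst z) powr (2*(1+\<gamma>)) + (1+\<gamma>)\<^sup>2 * (norm (snd z))\<^sup>2) powr (1 / (2*(1+\<gamma>)))"

text \<open>|grad_gamma rho|^2 = |x|^(2 gamma) / rho^(2 gamma), the explicit formula from the context.\<close>
definition grad_gauge_sq :: "real \<Rightarrow> (real^'m::finite) \<times> (real^'k::finite) \<Rightarrow> real" where
  "grad_gauge_sq \<gamma> z = norm (fst z) powr (2*\<gamma>) / gauge \<gamma> z powr (2*\<gamma>)"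

definition gball :: "real \<Rightarrow> real \<Rightarrow> ((real^'m::finite) \<times> (real^'k::finite)) set" where
  "gball \<gamma> r = {z. gauge \<gamma> z < r}"

definition hom_dim :: "real \<Rightarrow> 'm::finite itself \<Rightarrow> 'k::finite itself \<Rightarrow> real" where
  "hom_dim \<gamma> _ _ = real CARD('m) + (1+\<gamma>) * real CARD('k)"

end

theory Submission
  imports Defs
begin

text \<open>
  Write \<open>W = \<rho>\<^sup>\<alpha>\<^sup>-\<^sup>4 |\<nabla>\<rho>|\<^sup>2\<close>, \<open>\<l> = 1 / ln (r / \<rho>)\<close>, \<open>A = (Q + \<alpha> - 4) / 2\<close>, and let \<open>E\<close> be
  the generator of the anisotropic dilations. Integrating the derivative of a dilated integral gives
  \<open>\<integral> W \<phi> E\<phi> = - A \<integral> W \<phi>\<^sup>2\<close> and its analogue with the extra weight \<open>\<l>\<close>. Expanding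
  \<open>|\<nabla>\<phi> + (A + \<l>/2) \<phi> \<nabla>\<rho> / \<rho>|\<^sup>2 \<ge> 0\<close> then yields the Hardy inequality
  \<open>\<integral> \<rho>\<^sup>\<alpha>\<^sup>-\<^sup>2 |\<nabla>\<phi>|\<^sup>2 \<ge> A\<^sup>2 \<integral> W \<phi>\<^sup>2 + (1/4) \<integral> W \<l>\<^sup>2 \<phi>\<^sup>2\<close>. Testing \<open>\<Delta>\<phi>\<close> against \<open>\<rho>\<^sup>\<alpha>\<^sup>-\<^sup>2 \<phi>\<close>
  and applying Young's inequality with parameter \<open>\<epsilon> = A (Q - \<alpha>) / 4\<close>, the value maximising the
  resulting gradient constant, gives the claim. All integrands are dominated by a multiple of
  \<open>\<rho>\<^sup>\<alpha>\<^sup>-\<^sup>4\<close> on the ball, which is integrable because \<open>\<alpha> > 2\<close>.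
\<close>

section \<open>Integrals along measure-preserving flows\<close>

text \<open>\<open>ennreal\<close> sends negative values to 0, so the right side is the integral of
  the positive part alone, from which the left side still subtracts the negative part. This links
  signed identities to a possibly infinite integral.\<close>

lemma ennreal_integral_le_nn_integral:
  assumes f: "integrable M f"
  shows "ennreal (integral\<^sup>L M f) \<le> (\<integral>\<^sup>+x. ennreal (f x) \<partial>M)"
proof -
  have "(\<integral>\<^sup>+x. ennreal (f x) \<partial>M) < top"
    using f by (auto simp: real_integrable_def less_top)
  then have "(\<integral>\<^sup>+x. ennreal (f x) \<partial>M) = ennreal (enn2real (\<integral>\<^sup>+x. ennreal (f x) \<partial>M))" by simp
  moreover have "integral\<^sup>L M f \<le> enn2real (\<integral>\<^sup>+x. ennreal (f x) \<partial>M)"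
    by (simp add: real_lebesgue_integral_def[OF f])
  ultimately show ?thesis by (metis ennreal_leI)
qed

text \<open>Invariance is known for nonnegative functions only. Applied to the absolute value of
  \<open>f\<close> it gives integrability; applied to \<open>f\<close> and \<open>- f\<close> it
  matches the two parts that make up the integral.\<close>

lemma
  fixes T :: "'a::euclidean_space \<Rightarrow> 'a" and c :: real and f :: "'a \<Rightarrow> real"
  assumes T [measurable]: "T \<in> borel_measurable borel" and c: "c \<ge> 0"
    and inv: "\<And>h::'a \<Rightarrow> ennreal. h \<in> borel_measurable borel \<Longrightarrow>
           (\<integral>\<^sup>+z. ennreal c * h (T z) \<partial>lborel) = (\<integral>\<^sup>+z. h z \<partial>lborel)"
    and f: "integrable lborel f"
  shows integrable_transport: "integrable lborel (\<lambda>z. c * f (T z))"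
    and integral_transport: "(\<integral>z. c * f (T z) \<partial>lborel) = (\<integral>z. f z \<partial>lborel)"
proof -
  have [measurable]: "f \<in> borel_measurable borel" using f by auto
  have eq: "(\<integral>\<^sup>+z. ennreal (c * h (T z)) \<partial>lborel) = (\<integral>\<^sup>+z. ennreal (h z) \<partial>lborel)"
    if [measurable]: "h \<in> borel_measurable borel" for h :: "'a \<Rightarrow> real"
    using inv[of "\<lambda>z. ennreal (h z)"] c by (simp add: ennreal_mult')
  show int: "integrable lborel (\<lambda>z. c * f (T z))"
    using f eq[of "\<lambda>z. \<bar>f z\<bar>"] c unfolding integrable_iff_bounded by (simp add: abs_mult)
  show "(\<integral>z. c * f (T z) \<partial>lborel) = (\<integral>z. f z \<partial>lborel)"
    unfolding real_lebesgue_integral_def[OF int] real_lebesgue_integral_def[OF f]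
    using eq[of f] eq[of "\<lambda>z. - f z"] by simp
qed

text \<open>Integrate \<open>d/ds (c(s) w \<circ> T\<^sub>s) = c(s) g \<circ> T\<^sub>s\<close> over \<open>s \<in> [0, 1]\<close> and over space, and swap: by
  invariance one side is \<open>\<integral> g\<close> and the other is \<open>\<integral> w - \<integral> w\<close>. Translations give integration by
  parts without cut-offs near the singularities, dilations the Euler identities.\<close>
lemma integral_flow_derivative_eq_0:
  fixes T :: "real \<Rightarrow> 'a::euclidean_space \<Rightarrow> 'a" and c :: "real \<Rightarrow> real"
  assumes T: "continuous_on UNIV (\<lambda>p. T (fst p) (snd p))"
    and c [measurable]: "c \<in> borel_measurable borel" and c_nonneg: "\<And>s. c s \<ge> 0"
    and inv: "\<And>s (h::'a \<Rightarrow> ennreal). h \<in> borel_measurable borel \<Longrightarrow>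
           (\<integral>\<^sup>+z. ennreal (c s) * h (T s z) \<partial>lborel) = (\<integral>\<^sup>+z. h z \<partial>lborel)"
    and w: "integrable lborel w" and g: "integrable lborel g"
    and flow: "AE z in lborel. continuous_on {0..1} (\<lambda>s. c s * w (T s z)) \<and>
          (\<exists>S. finite S \<and> (\<forall>s. s \<notin> S \<longrightarrow>
             ((\<lambda>s. c s * w (T s z)) has_real_derivative c s * g (T s z)) (at s)))"
  shows "(\<integral>z. g z \<partial>lborel) = 0"
proof -
  have [measurable]: "g \<in> borel_measurable borel" using g by auto
  have Tm: "(\<lambda>p. T (fst p) (snd p)) \<in> borel_measurable (borel \<Otimes>\<^sub>M borel)"
    using T by (simp add: borel_prod borel_measurable_continuous_onI)
  have Ts [measurable]: "T s \<in> borel_measurable borel" for s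
    using measurable_Pair2[OF Tm, of s] by simp
  \<comment> \<open>Restricting time to [0, 1] makes the function integrable on the product, since
    by invariance its L1 norm in \<open>z\<close> is the same at each time of the interval.\<close>
  define h where "h = (\<lambda>(s, z). indicator {0..1} s * (c s * g (T s z)) :: real)"
  have "(\<lambda>p. g (T (fst p) (snd p))) \<in> borel_measurable (borel \<Otimes>\<^sub>M borel)"
    using measurable_compose[OF Tm, of g borel] by simp
  then have hm: "h \<in> borel_measurable (lborel \<Otimes>\<^sub>M lborel)"
    unfolding h_def by (simp add: split_beta')
  have int_s: "integrable lborel (\<lambda>z. c s * g (T s z))" "(\<integral>z. c s * g (T s z) \<partial>lborel) = integral\<^sup>L lborel g" for s
    using integrable_transport[OF Ts c_nonneg inv g] integral_transport[OF Ts c_nonneg inv g] by auto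
  have "integrable lborel (\<lambda>z. \<bar>g z\<bar>)" using g by simp
  from integral_transport[OF Ts c_nonneg inv this]
  have abs_s: "(\<integral>z. norm (h (s, z)) \<partial>lborel) = indicator {0..1} s * (\<integral>z. \<bar>g z\<bar> \<partial>lborel)" for s
    using c_nonneg[of s] by (simp add: h_def abs_mult)
  have h_int: "integrable (lborel \<Otimes>\<^sub>M lborel) h"
  proof (rule lborel_pair.Fubini_integrable[OF hm])
    show "integrable lborel (\<lambda>s. \<integral>z. norm (h (s, z)) \<partial>lborel)"
      unfolding abs_s by (intro integrable_mult_left) (simp add: integrable_indicator_iff)
    show "AE s in lborel. integrable lborel (\<lambda>z. h (s, z))"
      using int_s(1) by (auto simp: h_def)
  qed
  have "(\<integral>z. (\<integral>s. h (s, z) \<partial>lborel) \<partial>lborel) = (\<integral>s. (\<integral>z. h (s, z) \<partial>lborel) \<partial>lborel)"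
    using lborel_pair.Fubini_integral[of "\<lambda>s z. h (s, z)"] h_int by simp
  also have "\<dots> = (\<integral>s. indicator {0..1::real} s * integral\<^sup>L lborel g \<partial>lborel)"
    unfolding h_def prod.case integral_mult_right_zero int_s(2)[unfolded integral_mult_right_zero] by (rule refl)
  also have "\<dots> = integral\<^sup>L lborel g" by simp
  finally have 1: "integral\<^sup>L lborel g = (\<integral>z. (\<integral>s. h (s, z) \<partial>lborel) \<partial>lborel)" ..
  have "AE z in lborel. integrable lborel (\<lambda>s. h (s, z))"
    using lborel_pair.AE_integrable_snd[of "\<lambda>s z. h (s, z)"] h_int by simp
  then have "AE z in lborel. (\<integral>s. h (s, z) \<partial>lborel) = c 1 * w (T 1 z) - c 0 * w (T 0 z)"
    using flow
  proof eventually_elim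
    case (elim z)
    let ?f = "\<lambda>s. c s * w (T s z)" and ?f' = "\<lambda>s. c s * g (T s z)"
    from elim obtain S where "finite S" "\<And>s. s \<notin> S \<Longrightarrow> (?f has_real_derivative ?f' s) (at s)"
      by blast
    \<comment> \<open>Continuity on the closed interval lets the fundamental theorem of calculus
      tolerate the finitely many times in \<open>S\<close>.\<close>
    then have "(?f' has_integral (?f 1 - ?f 0)) {0..1}"
      using elim by (intro fundamental_theorem_of_calculus_interior_strong[of S])
        (auto simp: has_real_derivative_iff_has_vector_derivative)
    then have "((\<lambda>s. h (s, z)) has_integral (?f 1 - ?f 0)) UNIV"
      unfolding has_integral_restrict_UNIV[of "{0..1}", symmetric] h_def
      by (rule has_integral_eq[rotated]) (auto simp: indicator_def)
    moreover have "((\<lambda>s. h (s, z)) has_integral (\<integral>s. h (s, z) \<partial>lborel)) UNIV"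
      using elim by (intro has_integral_integral_lborel) auto
    ultimately show ?case by (rule has_integral_unique[rotated])
  qed
  then have "(\<integral>z. (\<integral>s. h (s, z) \<partial>lborel) \<partial>lborel) = (\<integral>z. c 1 * w (T 1 z) - c 0 * w (T 0 z) \<partial>lborel)"
  proof (rule integral_cong_AE[rotated -1])
    show "(\<lambda>z. \<integral>s. h (s, z) \<partial>lborel) \<in> borel_measurable lborel"
      using lborel_pair.integrable_snd[of "\<lambda>s z. h (s, z)"] h_int by auto
    show "(\<lambda>z. c 1 * w (T 1 z) - c 0 * w (T 0 z)) \<in> borel_measurable lborel"
      using w by measurable
  qed
  also have "\<dots> = 0"
    using integrable_transport[OF Ts c_nonneg inv w] integral_transport[OF Ts c_nonneg inv w]
    by (subst Bochner_Integration.integral_diff) auto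
  finally show ?thesis using 1 by simp
qed

section \<open>Anisotropic dilations and their Jacobian\<close>

definition dil :: "real \<Rightarrow> real \<Rightarrow> (real^'m::finite) \<times> (real^'k::finite) \<Rightarrow> (real^'m) \<times> (real^'k)" where
  "dil \<gamma> s z = (exp s *\<^sub>R fst z, exp ((1 + \<gamma>) * s) *\<^sub>R snd z)"

lemma nn_integral_scaleR:
  fixes h :: "'a::euclidean_space \<Rightarrow> ennreal"
  assumes [measurable]: "h \<in> borel_measurable borel" and "c > 0"
  shows "(\<integral>\<^sup>+x. h x \<partial>lborel) = (\<integral>\<^sup>+x. ennreal (c ^ DIM('a)) * h (c *\<^sub>R x) \<partial>lborel)"
  using assms(2)
  by (subst lborel_affine[of c 0]) (auto simp: nn_integral_density nn_integral_distr)

text \<open>By Tonelli the two factors scale separately. Their Jacobians exp(m s) and exp((1 +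
  \<gamma>) k s) multiply to exp(Q s), which is how the homogeneous dimension enters.\<close>

lemma nn_integral_dil:
  fixes h :: "(real^'m::finite) \<times> (real^'k::finite) \<Rightarrow> ennreal"
  assumes [measurable]: "h \<in> borel_measurable borel"
  shows "(\<integral>\<^sup>+z. ennreal (exp (hom_dim \<gamma> TYPE('m) TYPE('k) * s)) * h (dil \<gamma> s z) \<partial>lborel) = (\<integral>\<^sup>+z. h z \<partial>lborel)"
proof -
  have [measurable]: "h \<in> borel_measurable (borel \<Otimes>\<^sub>M borel)"
    by (simp add: borel_prod)
  define a where "a = exp s ^ CARD('m)"
  define b where "b = exp ((1 + \<gamma>) * s) ^ CARD('k)"
  have e: "exp (hom_dim \<gamma> TYPE('m) TYPE('k) * s) = a * b"
    by (simp add: hom_dim_def a_def b_def algebra_simps exp_add flip: exp_of_nat_mult)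
  have "(\<integral>\<^sup>+z. ennreal (a * b) * h (dil \<gamma> s z) \<partial>lborel)
     = (\<integral>\<^sup>+x. (\<integral>\<^sup>+y. ennreal a * (ennreal b * h (exp s *\<^sub>R x, exp ((1 + \<gamma>) * s) *\<^sub>R y)) \<partial>lborel) \<partial>lborel)"
    unfolding lborel_prod[symmetric] dil_def
    by (subst lborel.nn_integral_fst[symmetric]) (auto simp: ennreal_mult' a_def mult.assoc)
  also have "\<dots> = (\<integral>\<^sup>+x. ennreal a * (\<integral>\<^sup>+y. h (exp s *\<^sub>R x, y) \<partial>lborel) \<partial>lborel)"
    by (subst nn_integral_scaleR[where c = "exp ((1 + \<gamma>) * s)" and 'a = "real^'k"]) (auto simp: nn_integral_cmult b_def)
  also have "\<dots> = (\<integral>\<^sup>+x. (\<integral>\<^sup>+y. h (x, y) \<partial>lborel) \<partial>lborel)"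
    by (subst nn_integral_scaleR[where c = "exp s" and 'a = "real^'m" and h="\<lambda>x. \<integral>\<^sup>+y. h (x, y) \<partial>lborel"]) (auto simp: a_def)
  also have "\<dots> = (\<integral>\<^sup>+z. h z \<partial>lborel)"
    unfolding lborel_prod[symmetric]
    by (subst lborel.nn_integral_fst) auto
  finally show ?thesis by (simp add: e)
qed

section \<open>The gauge\<close>

text \<open>Reflection bounds the integral by twice that of \<open>t powr a\<close> over [0, R],
  which converges because a > -1.\<close>

lemma nn_integral_abs_powr_finite:
  fixes R a :: real
  assumes "a > -1" "R \<ge> 0"
  shows "(\<integral>\<^sup>+t. ennreal (indicator {-R..R} t * \<bar>t\<bar> powr a) \<partial>lborel) < \<infinity>"
proof -
  let ?h = "\<lambda>t. ennreal (indicator {0..R} t * t powr a)"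
  have "integral\<^sup>N lborel ?h = R powr (a + 1) / (a + 1)"
    using has_integral_powr_from_0[of a R] assms
    by (intro nn_integral_has_integral_lebesgue) auto
  then have fin: "integral\<^sup>N lborel ?h < \<infinity>" by simp
  have "(\<integral>\<^sup>+t. ennreal (indicator {-R..R} t * \<bar>t\<bar> powr a) \<partial>lborel) \<le> (\<integral>\<^sup>+t. ?h t + ?h (0 + (-1) * t) \<partial>lborel)"
    by (intro nn_integral_mono) (auto simp: indicator_def)
  also have "\<dots> = integral\<^sup>N lborel ?h + (\<integral>\<^sup>+t. ?h (0 + (-1) * t) \<partial>lborel)"
    by (rule nn_integral_add) auto
  also have "(\<integral>\<^sup>+t. ?h (0 + (-1) * t) \<partial>lborel) = integral\<^sup>N lborel ?h"
    by (subst nn_integral_real_affine[of ?h "-1" 0]) auto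
  finally show ?thesis using fin by (simp add: order_le_less_trans)
qed

lemma AE_inner_ne_0:
  fixes b :: "'a::euclidean_space"
  assumes "b \<noteq> 0"
  shows "AE z in lborel. z \<bullet> b \<noteq> 0"
proof -
  have "{z. b \<bullet> z = 0} \<in> null_sets lebesgue"
    using negligible_hyperplane[of b 0] assms by (simp add: negligible_iff_null_sets)
  then have "{z. b \<bullet> z = 0} \<in> null_sets lborel"
    by (subst (asm) null_sets_completion_iff) (auto intro: borel_closed closed_hyperplane)
  from AE_not_in[OF this] show ?thesis by (simp add: inner_commute)
qed

text \<open>The set x = 0 lies in a coordinate hyperplane because m \<ge> 1. It has to be avoided
  since \<open>grad_gauge_sq\<close> vanishes there and the derivative formula for the gauge is
  proved only off it.\<close>

lemma AE_fst_ne_0: "AE z::(real^'m::finite) \<times> (real^'k::finite) in lborel. fst z \<noteq> 0"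
proof -
  obtain i :: 'm where True by simp
  have "AE z::(real^'m) \<times> (real^'k) in lborel. z \<bullet> (axis i 1, 0) \<noteq> 0"
    by (rule AE_inner_ne_0) (simp add: prod_eq_iff axis_eq_0_iff)
  then show ?thesis by eventually_elim (auto simp: inner_prod_def)
qed

section \<open>Elementary bounds, continuity and measurability of the gauge\<close>

lemma measurable_fst_snd_cart [measurable]:
  "(fst :: (real^'m::finite) \<times> (real^'k::finite) \<Rightarrow> _) \<in> borel_measurable borel"
  "(snd :: (real^'m::finite) \<times> (real^'k::finite) \<Rightarrow> _) \<in> borel_measurable borel"
  by (auto intro!: borel_measurable_continuous_onI continuous_intros)

lemma gauge_nonneg: "gauge \<gamma> z \<ge> 0"
  by (simp add: gauge_def)

lemma gauge_powr:
  assumes "\<gamma> > 0"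
  shows "gauge \<gamma> z powr (2 * (1 + \<gamma>)) = norm (fst z) powr (2 * (1 + \<gamma>)) + (1 + \<gamma>)\<^sup>2 * (norm (snd z))\<^sup>2"
  using assms by (simp add: gauge_def powr_powr)

lemma gauge_eq_0_iff:
  assumes "\<gamma> > 0"
  shows "gauge \<gamma> z = 0 \<longleftrightarrow> z = 0"
proof -
  have "gauge \<gamma> z = 0 \<longleftrightarrow> norm (fst z) powr (2*(1+\<gamma>)) + (1+\<gamma>)\<^sup>2 * (norm (snd z))\<^sup>2 = 0"
    unfolding gauge_def by simp
  also have "\<dots> \<longleftrightarrow> norm (fst z) powr (2*(1+\<gamma>)) = 0 \<and> (1+\<gamma>)\<^sup>2 * (norm (snd z))\<^sup>2 = 0"
    by (rule add_nonneg_eq_0_iff) auto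
  finally show ?thesis using assms by (auto simp: prod_eq_iff)
qed

lemma gauge_pos:
  assumes "\<gamma> > 0" "z \<noteq> 0"
  shows "gauge \<gamma> z > 0"
  using gauge_eq_0_iff[of \<gamma> z] gauge_nonneg[of \<gamma> z] assms by (auto simp: less_le)

lemma norm_fst_le_gauge:
  assumes "\<gamma> > 0"
  shows "norm (fst z) \<le> gauge \<gamma> z"
proof -
  have "norm (fst z) powr (2 * (1 + \<gamma>)) \<le> gauge \<gamma> z powr (2 * (1 + \<gamma>))"
    using gauge_powr[OF assms, of z] by simp
  then show ?thesis
    using assms by (meson gauge_nonneg add_pos_pos mult_pos_pos not_le powr_less_mono2 zero_less_numeral zero_less_one)
qed

lemma norm_snd_le_gauge:
  assumes "\<gamma> > 0"
  shows "(1 + \<gamma>) * norm (snd z) \<le> gauge \<gamma> z powr (1 + \<gamma>)"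
proof -
  have "((1 + \<gamma>) * norm (snd z))\<^sup>2 \<le> gauge \<gamma> z powr (2 * (1 + \<gamma>))"
    using gauge_powr[OF assms, of z] by (simp add: power_mult_distrib)
  also have "\<dots> = (gauge \<gamma> z powr (1 + \<gamma>))\<^sup>2"
    by (metis mult_2 power2_eq_square powr_add)
  finally show ?thesis by (rule power2_le_imp_le) simp
qed

lemma continuous_on_gauge:
  assumes "\<gamma> > 0"
  shows "continuous_on UNIV (gauge \<gamma> :: (real^'m::finite) \<times> (real^'k::finite) \<Rightarrow> real)"
  unfolding gauge_def using assms
  by (intro continuous_intros continuous_on_powr' ) auto

lemma measurable_gauge [measurable]:
  "(gauge \<gamma> :: (real^'m::finite) \<times> (real^'k::finite) \<Rightarrow> real) \<in> borel_measurable borel"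
  unfolding gauge_def by measurable

lemma measurable_grad_gauge_sq [measurable]:
  "(grad_gauge_sq \<gamma> :: (real^'m::finite) \<times> (real^'k::finite) \<Rightarrow> real) \<in> borel_measurable borel"
  unfolding grad_gauge_sq_def by measurable

lemma measurable_gball [measurable]:
  "(gball \<gamma> r :: ((real^'m::finite) \<times> (real^'k::finite)) set) \<in> sets borel"
  unfolding gball_def by measurable

text \<open>On the ball \<rho> dominates one coordinate of x, and \<rho> to the power 1 + \<gamma>
  dominates one coordinate of y. A negative power of \<rho> is therefore bounded by a product of
  one-variable powers on a box, and Tonelli applies.\<close>

lemma integrable_gauge_powr_aux:
  fixes \<gamma> q r :: real
  assumes \<gamma>: "\<gamma> > 0" and q: "-2 < q" "q < 0" and r: "r > 0"
  shows "integrable lborel (\<lambda>z::(real^'m::finite) \<times> (real^'k::finite). indicator (gball \<gamma> r) z * gauge \<gamma> z powr q)"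
proof -
  obtain i :: 'm and j :: 'k where True by simp
  define bi :: "(real^'m) \<times> (real^'k)" where "bi = (axis i 1, 0)"
  define bj :: "(real^'m) \<times> (real^'k)" where "bj = (0, axis j 1)"
  have B: "bi \<in> Basis" "bj \<in> Basis" "bi \<noteq> bj"
    by (auto simp: bi_def bj_def Basis_prod_def axis_eq_axis Basis_vec_def)
  define e where "e b = (if b = bi then q / 2 else if b = bj then q / (2 * (1 + \<gamma>)) else 0)" for b
  have e: "-1 < e b" for b
    using q \<gamma> mult_strict_mono[of 1 "1+\<gamma>" 1 1] by (auto simp: e_def field_simps)
  \<comment> \<open>Half the side of a cube containing the ball: there |x| is at most \<rho> < r,
    and |y| is at most \<open>\<rho> powr (1 + \<gamma>)\<close>, hence at most
    \<open>r powr (1 + \<gamma>)\<close>.\<close>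
  define R where "R = max r (r powr (1 + \<gamma>))"
  have R: "R > 0" using r by (simp add: R_def less_max_iff_disj)
  define F where "F b t = indicator {-R..R} t * \<bar>t\<bar> powr e b" for b :: "(real^'m) \<times> (real^'k)" and t :: real
  have F: "F b \<in> borel_measurable borel" "F b t \<ge> 0" for b t
    unfolding F_def by simp_all
  have fin: "(\<integral>\<^sup>+z. (\<Prod>b\<in>Basis. ennreal (F b (z \<bullet> b))) \<partial>(lborel :: ((real^'m) \<times> (real^'k)) measure)) < \<infinity>"
    unfolding F_def
    using e R by (subst nn_integral_lborel_prod) (auto simp: less_top[symmetric] ennreal_prod_eq_top nn_integral_abs_powr_finite[unfolded infinity_ennreal_def, THEN less_imp_neq])
  show ?thesis
  proof (rule integrableI_bounded)
    show "(\<lambda>z. indicator (gball \<gamma> r) z * gauge \<gamma> z powr q) \<in> borel_measurable (lborel :: ((real^'m) \<times> (real^'k)) measure)"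
      by measurable
    \<comment> \<open>Since \<open>0 powr a = 0\<close> for every \<open>a\<close>, the product of
      the \<open>F b\<close> vanishes on the coordinate hyperplanes and bounds nothing there. They
      form a null set.\<close>
    have "AE z in (lborel :: ((real^'m) \<times> (real^'k)) measure). \<forall>b\<in>Basis. z \<bullet> b \<noteq> 0"
      by (intro AE_finite_allI AE_inner_ne_0) auto
    then have "(\<integral>\<^sup>+z. ennreal (norm (indicator (gball \<gamma> r) z * gauge \<gamma> z powr q)) \<partial>(lborel :: ((real^'m) \<times> (real^'k)) measure))
         \<le> (\<integral>\<^sup>+z. (\<Prod>b\<in>Basis. ennreal (F b (z \<bullet> b))) \<partial>lborel)"
    proof (intro nn_integral_mono_AE, eventually_elim)
      case (elim z)
      then have nz: "z \<bullet> bi \<noteq> 0" "z \<bullet> bj \<noteq> 0" using B by auto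
      show "ennreal (norm (indicator (gball \<gamma> r) z * gauge \<gamma> z powr q)) \<le> (\<Prod>b\<in>Basis. ennreal (F b (z \<bullet> b)))"
      proof (cases "z \<in> gball \<gamma> r")
        case True
        then have lt: "gauge \<gamma> z < r" by (simp add: gball_def)
        have x: "\<bar>z \<bullet> bi\<bar> \<le> gauge \<gamma> z"
          using norm_fst_le_gauge[OF \<gamma>, of z] component_le_norm_cart[of "fst z" i]
          by (simp add: bi_def inner_prod_def inner_axis)
        have "1 * norm (snd z) \<le> (1 + \<gamma>) * norm (snd z)"
          using \<gamma> by (intro mult_right_mono) auto
        then have y': "norm (snd z) \<le> gauge \<gamma> z powr (1 + \<gamma>)"
          using norm_snd_le_gauge[OF \<gamma>, of z] by simp
        then have y: "\<bar>z \<bullet> bj\<bar> \<le> gauge \<gamma> z powr (1 + \<gamma>)"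
          using component_le_norm_cart[of "snd z" j]
          by (simp add: bj_def inner_prod_def inner_axis)
        have "gauge \<gamma> z powr (1 + \<gamma>) \<le> r powr (1 + \<gamma>)"
          using lt \<gamma> gauge_nonneg[of \<gamma> z] by (intro powr_mono2) auto
        then have "norm (fst z) \<le> R" "norm (snd z) \<le> R"
          using y' norm_fst_le_gauge[OF \<gamma>, of z] lt by (auto simp: R_def)
        then have zb: "\<bar>z \<bullet> b\<bar> \<le> R" if "b \<in> Basis" for b
          using that Basis_le_norm[of _ "fst z"] Basis_le_norm[of _ "snd z"]
          by (fastforce simp: Basis_prod_def inner_prod_def)
        have g: "gauge \<gamma> z > 0" using x nz by linarith
        \<comment> \<open>Splitting the singularity evenly between one coordinate of each factor keeps both one-dimensional
          exponents above \<open>-1\<close>.\<close>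
        have eq: "q / 2 + (1 + \<gamma>) * (q / (2 * (1 + \<gamma>))) = q"
          using \<gamma> by (simp add: field_simps)
        have "gauge \<gamma> z powr q = gauge \<gamma> z powr (q / 2) * (gauge \<gamma> z powr (1 + \<gamma>)) powr (q / (2 * (1 + \<gamma>)))"
          by (simp only: powr_powr powr_add[symmetric] eq)
        also have "\<dots> \<le> \<bar>z \<bullet> bi\<bar> powr (q / 2) * \<bar>z \<bullet> bj\<bar> powr (q / (2 * (1 + \<gamma>)))"
          using x y nz q \<gamma> by (intro mult_mono powr_mono2') (auto simp: field_simps)
        also have "\<dots> = F bi (z \<bullet> bi) * F bj (z \<bullet> bj)"
          using zb[OF B(1)] zb[OF B(2)] B(3) by (simp add: F_def e_def abs_le_iff minus_le_iff)
        also have "\<dots> = (\<Prod>b\<in>{bi, bj}. F b (z \<bullet> b))"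
          using B(3) by simp
        also have "\<dots> = (\<Prod>b\<in>Basis. F b (z \<bullet> b))"
        proof (rule prod.mono_neutral_left)
          show "\<forall>b\<in>Basis - {bi, bj}. F b (z \<bullet> b) = 1"
            using zb elim by (auto simp: F_def e_def abs_le_iff minus_le_iff)
        qed (use B in auto)
        finally show ?thesis
          using True F(2) by (simp add: prod_ennreal ennreal_leI)
      qed auto
    qed
    then show "(\<integral>\<^sup>+z. ennreal (norm (indicator (gball \<gamma> r) z * gauge \<gamma> z powr q)) \<partial>(lborel :: ((real^'m) \<times> (real^'k)) measure)) < \<infinity>"
      using fin by (rule order_le_less_trans)
  qed
qed

text \<open>On the ball a power of \<rho> is at most a constant times any more singular power, so
  every exponent above -2 reduces to one in (-2, 0), here \<open>min q (-1)\<close>.\<close>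

lemma integrable_gauge_powr:
  fixes \<gamma> q r :: real
  assumes \<gamma>: "\<gamma> > 0" and q: "-2 < q" and r: "r > 0"
  shows "integrable lborel (\<lambda>z::(real^'m::finite) \<times> (real^'k::finite). indicator (gball \<gamma> r) z * gauge \<gamma> z powr q)"
proof -
  define p where "p = min q (-1)"
  have int: "integrable lborel (\<lambda>z::(real^'m) \<times> (real^'k). r powr (q - p) * (indicator (gball \<gamma> r) z * gauge \<gamma> z powr p))"
    using \<gamma> r q by (intro integrable_mult_right integrable_gauge_powr_aux) (auto simp: p_def)
  show ?thesis
  proof (rule Bochner_Integration.integrable_bound[OF int])
    show "AE z::(real^'m) \<times> (real^'k) in lborel. norm (indicator (gball \<gamma> r) z * gauge \<gamma> z powr q)
        \<le> norm (r powr (q - p) * (indicator (gball \<gamma> r) z * gauge \<gamma> z powr p))"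
    proof (intro AE_I2)
      fix z :: "(real^'m) \<times> (real^'k)"
      show "norm (indicator (gball \<gamma> r) z * gauge \<gamma> z powr q) \<le> norm (r powr (q - p) * (indicator (gball \<gamma> r) z * gauge \<gamma> z powr p))"
      proof (cases "z \<in> gball \<gamma> r")
        case True
        have "gauge \<gamma> z powr q = gauge \<gamma> z powr (q - p) * gauge \<gamma> z powr p"
          by (simp flip: powr_add)
        also have "\<dots> \<le> r powr (q - p) * gauge \<gamma> z powr p"
          using True gauge_nonneg[of \<gamma> z] by (intro mult_right_mono powr_mono2) (auto simp: p_def gball_def)
        finally show ?thesis using True by (simp add: abs_mult)
      qed auto
    qed
  qed measurable
qed

section \<open>Translations, derivatives of gauge powers, and homogeneity\<close>

lemma nn_integral_translate:
  fixes h :: "'a::euclidean_space \<Rightarrow> ennreal"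
  assumes [measurable]: "h \<in> borel_measurable borel"
  shows "(\<integral>\<^sup>+z. h (z + b) \<partial>lborel) = (\<integral>\<^sup>+z. h z \<partial>lborel)"
  by (subst (2) lborel_distr_plus[of b, symmetric]) (simp add: nn_integral_distr add.commute)

lemma has_real_derivative_along_line:
  fixes f :: "'a::real_normed_vector \<Rightarrow> real"
  assumes "(f has_derivative D) (at (z + s *\<^sub>R b))"
  shows "((\<lambda>s. f (z + s *\<^sub>R b)) has_real_derivative D b) (at s)"
proof -
  have "((\<lambda>s. z + s *\<^sub>R b) has_derivative (\<lambda>h. h *\<^sub>R b)) (at s)"
    by (auto intro!: derivative_eq_intros)
  from has_derivative_compose[OF this assms]
  have "((\<lambda>s. f (z + s *\<^sub>R b)) has_derivative (\<lambda>h. D (h *\<^sub>R b))) (at s)" .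
  moreover have "D (h *\<^sub>R b) = h * D b" for h
    using assms by (simp add: has_derivative_bounded_linear linear_cmul bounded_linear.linear)
  ultimately show ?thesis
    by (intro has_derivative_imp_has_field_derivative) auto
qed

text \<open>The power is the composite of a real power with \<open>N\<close>, in which |x| occurs
  only through the inner product of x with itself. Off x = 0 both real powers have a positive base,
  so the chain rule applies.\<close>

lemma gauge_powr_has_derivative:
  fixes z :: "(real^'m::finite) \<times> (real^'k::finite)"
  assumes \<gamma>: "\<gamma> > 0" and z: "fst z \<noteq> 0"
  shows "((\<lambda>z. gauge \<gamma> z powr p) has_derivative
     (\<lambda>h. p * gauge \<gamma> z powr (p - 2 - 2 * \<gamma>) *
       (norm (fst z) powr (2 * \<gamma>) * (fst z \<bullet> fst h) + (1 + \<gamma>) * (snd z \<bullet> snd h)))) (at z)"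
proof -
  define N where "N z = (fst z \<bullet> fst z) powr (1 + \<gamma>) + (1 + \<gamma>)\<^sup>2 * (snd z \<bullet> snd z)" for z :: "(real^'m) \<times> (real^'k)"
  have sq: "(x \<bullet> x) powr a = norm x powr (2 * a)" for x :: "real^'m" and a
    by (simp add: dot_square_norm powr_powr flip: powr_numeral)
  have N: "gauge \<gamma> z powr q = N z powr (q / (2 * (1 + \<gamma>)))" for z :: "(real^'m) \<times> (real^'k)" and q
    unfolding N_def sq gauge_def by (simp add: powr_powr dot_square_norm)
  have pos: "fst z \<bullet> fst z > 0" using z by simp
  then have Npos: "N z > 0"
    unfolding N_def by (intro add_pos_nonneg) auto
  have "((\<lambda>z. (fst z \<bullet> fst z) powr (1 + \<gamma>)) has_derivative
      (\<lambda>h. (fst z \<bullet> fst h + fst h \<bullet> fst z) * ((1 + \<gamma>) * (fst z \<bullet> fst z) powr (1 + \<gamma> - 1)))) (at z)"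
    by (rule DERIV_compose_FDERIV[where g = "\<lambda>z. fst z \<bullet> fst z", OF has_real_derivative_powr[OF pos]]) (auto intro!: derivative_eq_intros)
  then have "(N has_derivative
      (\<lambda>h. (fst z \<bullet> fst h + fst h \<bullet> fst z) * ((1 + \<gamma>) * (fst z \<bullet> fst z) powr (1 + \<gamma> - 1))
        + (1 + \<gamma>)\<^sup>2 * (snd z \<bullet> snd h + snd h \<bullet> snd z))) (at z)"
    unfolding N_def by (rule has_derivative_add) (auto intro!: derivative_eq_intros)
  from DERIV_compose_FDERIV[OF has_real_derivative_powr[OF Npos] this, of "p / (2 * (1 + \<gamma>))"]
  have "((\<lambda>z. gauge \<gamma> z powr p) has_derivative (\<lambda>h.
      ((fst z \<bullet> fst h + fst h \<bullet> fst z) * ((1 + \<gamma>) * norm (fst z) powr (2 * \<gamma>))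
        + (1 + \<gamma>)\<^sup>2 * (snd z \<bullet> snd h + snd h \<bullet> snd z))
        * (p / (2 * (1 + \<gamma>)) * N z powr (p / (2 * (1 + \<gamma>)) - 1)))) (at z)"
    unfolding N by (simp add: sq)
  also have "p / (2 * (1 + \<gamma>)) - 1 = (p - 2 - 2 * \<gamma>) / (2 * (1 + \<gamma>))"
    using \<gamma> by (simp add: field_simps)
  also have "N z powr \<dots> = gauge \<gamma> z powr (p - 2 - 2 * \<gamma>)" by (simp add: N)
  finally show ?thesis
    by (rule has_derivative_eq_rhs)
      (use \<gamma> in \<open>simp add: fun_eq_iff inner_commute power2_eq_square field_simps\<close>)
qed

lemma gauge_dil:
  assumes "\<gamma> > 0"
  shows "gauge \<gamma> (dil \<gamma> s z) = exp s * gauge \<gamma> z"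
proof -
  have "norm (fst (dil \<gamma> s z)) powr (2 * (1 + \<gamma>)) + (1 + \<gamma>)\<^sup>2 * (norm (snd (dil \<gamma> s z)))\<^sup>2
    = exp (2 * (1 + \<gamma>) * s) * (norm (fst z) powr (2 * (1 + \<gamma>)) + (1 + \<gamma>)\<^sup>2 * (norm (snd z))\<^sup>2)"
    by (simp add: dil_def powr_mult power_mult_distrib exp_powr_real algebra_simps exp_double[symmetric]
        flip: exp_add)
  then show ?thesis
    unfolding gauge_def using assms by (simp add: powr_mult exp_powr_real)
qed

lemma grad_gauge_sq_dil:
  assumes "\<gamma> > 0"
  shows "grad_gauge_sq \<gamma> (dil \<gamma> s z) = grad_gauge_sq \<gamma> z"
  unfolding grad_gauge_sq_def gauge_dil[OF assms]
  by (simp add: dil_def powr_mult exp_powr_real)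

lemma grad_gauge_sq_bounds:
  assumes "\<gamma> > 0"
  shows "0 \<le> grad_gauge_sq \<gamma> z" "grad_gauge_sq \<gamma> z \<le> 1"
proof -
  show "0 \<le> grad_gauge_sq \<gamma> z" by (simp add: grad_gauge_sq_def)
  have "norm (fst z) powr (2 * \<gamma>) \<le> gauge \<gamma> z powr (2 * \<gamma>)"
    using assms norm_fst_le_gauge[OF assms, of z] by (intro powr_mono2) auto
  then show "grad_gauge_sq \<gamma> z \<le> 1"
    by (auto simp: grad_gauge_sq_def divide_le_eq_1 less_le)
qed

text \<open>The generator of \<open>dil\<close>. It stands in for the gradient of the gauge: off x =
  0 the inner product of the Grushin gradients of \<rho> and f equals \<open>grad_gauge_sq \<gamma>
  z * euler_deriv \<gamma> f z / gauge \<gamma> z\<close>.\<close>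

definition euler_deriv :: "real \<Rightarrow> ((real^'m::finite) \<times> (real^'k::finite) \<Rightarrow> real) \<Rightarrow> (real^'m) \<times> (real^'k) \<Rightarrow> real" where
  "euler_deriv \<gamma> f z = (\<Sum>i\<in>UNIV. fst z $ i * dx i f z) + (1 + \<gamma>) * (\<Sum>j\<in>UNIV. snd z $ j * dy j f z)"

lemma frechet_derivative_eq_euler_deriv:
  assumes "f differentiable (at z)"
  shows "frechet_derivative f (at z) (fst z, (1 + \<gamma>) *\<^sub>R snd z) = euler_deriv \<gamma> f z"
proof -
  let ?D = "frechet_derivative f (at z)"
  interpret linear ?D using linear_frechet_derivative[OF assms] .
  have x: "x = (\<Sum>i\<in>UNIV. (x $ i) *\<^sub>R axis i 1)" for x :: "real^'n::finite"
    using basis_expansion[of x] by (simp add: scalar_mult_eq_scaleR)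
  have "(fst z, (1 + \<gamma>) *\<^sub>R snd z) = (\<Sum>i\<in>UNIV. (fst z $ i) *\<^sub>R (axis i 1, 0)) + (1 + \<gamma>) *\<^sub>R (\<Sum>j\<in>UNIV. (snd z $ j) *\<^sub>R (0, axis j 1))"
    by (simp add: prod_eq_iff fst_sum snd_sum x[symmetric])
  then show ?thesis
    by (simp only: euler_deriv_def dx_def dy_def add sum scale real_scaleR_def)
qed

lemma has_real_derivative_along_dil:
  fixes f :: "(real^'m::finite) \<times> (real^'k::finite) \<Rightarrow> real"
  assumes "f differentiable (at (dil \<gamma> s z))"
  shows "((\<lambda>s. f (dil \<gamma> s z)) has_real_derivative euler_deriv \<gamma> f (dil \<gamma> s z)) (at s)"
proof -
  let ?D = "frechet_derivative f (at (dil \<gamma> s z))"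
  interpret linear ?D using linear_frechet_derivative[OF assms] .
  have "((\<lambda>s. dil \<gamma> s z) has_derivative (\<lambda>h. h *\<^sub>R (fst (dil \<gamma> s z), (1 + \<gamma>) *\<^sub>R snd (dil \<gamma> s z)))) (at s)"
    unfolding dil_def by (auto intro!: derivative_eq_intros simp: fun_eq_iff algebra_simps)
  from has_derivative_compose[OF this assms[unfolded frechet_derivative_works]]
  show ?thesis
    unfolding scale frechet_derivative_eq_euler_deriv[OF assms]
    by (rule has_derivative_imp_has_field_derivative) simp
qed

section \<open>Identities for a test function\<close>

lemma Ck_SucD: "Ck (Suc n) f \<Longrightarrow> f differentiable (at z)"
  by simp

locale grushin_bump =
  fixes \<gamma> \<alpha> r Q :: real and \<phi> :: "(real^'m::finite) \<times> (real^'k::finite) \<Rightarrow> real"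
  assumes Q: "Q = hom_dim \<gamma> TYPE('m) TYPE('k)" and \<gamma>: "\<gamma> > 0" and \<alpha>: "2 < \<alpha>" and r: "r > 0" and \<phi>: "\<phi> \<in> C0_infty (gball \<gamma> r)"
begin

abbreviation \<rho> :: "(real^'m) \<times> (real^'k) \<Rightarrow> real" where "\<rho> \<equiv> gauge \<gamma>"

abbreviation E :: "(real^'m) \<times> (real^'k) \<Rightarrow> real" where "E \<equiv> euler_deriv \<gamma> \<phi>"

definition K :: "((real^'m) \<times> (real^'k)) set" where "K = closure {z. \<phi> z \<noteq> 0}"

definition W :: "(real^'m) \<times> (real^'k) \<Rightarrow> real" where "W z = \<rho> z powr (\<alpha> - 4) * grad_gauge_sq \<gamma> z"

text \<open>At the origin \<open>r / 0 = 0\<close> and \<open>ln 0 = 0\<close> give the value 0,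
  which is also the limit there. The function blows up only at the boundary of the ball.\<close>

definition \<l> :: "(real^'m) \<times> (real^'k) \<Rightarrow> real" where "\<l> z = 1 / ln (r / \<rho> z)"

lemma K: "compact K" "K \<subseteq> gball \<gamma> r" "closed K"
  using \<phi> by (auto simp: K_def C0_infty_def)

lemma K_lt: "z \<in> K \<Longrightarrow> \<rho> z < r"
  using K(2) by (auto simp: gball_def)

lemma Ck: "Ck n \<phi>"
  using \<phi> by (auto simp: C0_infty_def smooth_fun_def)

lemma Ck_dx: "Ck n (dx i \<phi>)"
  using Ck[of "Suc n"] by (simp add: dx_def[abs_def])

lemma Ck_dy: "Ck n (dy j \<phi>)"
  using Ck[of "Suc n"] by (simp add: dy_def[abs_def])

lemma differentiable:
  "\<phi> differentiable (at z)" "dx i \<phi> differentiable (at z)" "dy j \<phi> differentiable (at z)"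
  using Ck_SucD Ck Ck_dx Ck_dy by blast+

lemma cont:
  "continuous_on UNIV \<phi>" "continuous_on UNIV (dx i \<phi>)" "continuous_on UNIV (dy j \<phi>)"
  "continuous_on UNIV (dx i (dx i \<phi>))" "continuous_on UNIV (dy j (dy j \<phi>))"
  using Ck[of 0] Ck_dx[of 0] Ck_dy[of 0] Ck_dx[of 1 i] Ck_dy[of 1 j]
  by (auto simp: dx_def[of i "dx i \<phi>", abs_def] dy_def[of j "dy j \<phi>", abs_def])

lemma \<phi>_0: "z \<notin> K \<Longrightarrow> \<phi> z = 0"
  using closure_subset[of "{z. \<phi> z \<noteq> 0}"] by (auto simp: K_def)

text \<open>The regular factor of the integrands: each is split into a possibly singular coefficient
  times a function of this class.\<close>

definition bump :: "((real^'m) \<times> (real^'k) \<Rightarrow> real) \<Rightarrow> bool" where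
  "bump f \<longleftrightarrow> continuous_on UNIV f \<and> (\<forall>z. z \<notin> K \<longrightarrow> f z = 0)"

lemma bump_\<phi>: "bump \<phi>" using cont \<phi>_0 by (auto simp: bump_def)

lemma bump_mult:
  assumes "bump f" "continuous_on UNIV g"
  shows "bump (\<lambda>z. f z * g z)"
  using assms by (auto simp: bump_def intro!: continuous_intros)

lemma bump_sum: "(\<And>i. i \<in> I \<Longrightarrow> bump (f i)) \<Longrightarrow> bump (\<lambda>z. \<Sum>i\<in>I. f i z)"
  by (auto simp: bump_def intro!: continuous_intros)

lemma frechet_derivative_0:
  assumes "\<And>z. z \<notin> K \<Longrightarrow> f z = 0" "z \<notin> K"
  shows "frechet_derivative f (at z) v = (0::real)"
proof -
  have "(f has_derivative (\<lambda>_. 0)) (at z)"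
    by (rule has_derivative_transform_within_open[of "\<lambda>_. 0" _ _ _ "- K"])
      (use assms K(3) in \<open>auto simp: open_Compl\<close>)
  from frechet_derivative_at[OF this] show ?thesis by metis
qed

lemma dx_0: "z \<notin> K \<Longrightarrow> dx i \<phi> z = 0" "z \<notin> K \<Longrightarrow> dx i (dx i \<phi>) z = 0"
  and dy_0: "z \<notin> K \<Longrightarrow> dy j \<phi> z = 0" "z \<notin> K \<Longrightarrow> dy j (dy j \<phi>) z = 0"
proof -
  show 1: "z \<notin> K \<Longrightarrow> dx i \<phi> z = 0" for z
    unfolding dx_def by (rule frechet_derivative_0[OF \<phi>_0])
  show 2: "z \<notin> K \<Longrightarrow> dy j \<phi> z = 0" for z
    unfolding dy_def by (rule frechet_derivative_0[OF \<phi>_0])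
  show "z \<notin> K \<Longrightarrow> dx i (dx i \<phi>) z = 0"
    unfolding dx_def[of i "dx i \<phi>"] by (rule frechet_derivative_0[OF 1])
  show "z \<notin> K \<Longrightarrow> dy j (dy j \<phi>) z = 0"
    unfolding dy_def[of j "dy j \<phi>"] by (rule frechet_derivative_0[OF 2])
qed

lemma bump_dx: "bump (dx i \<phi>)" and bump_dy: "bump (dy j \<phi>)"
  using cont dx_0 dy_0 by (auto simp: bump_def)

lemma cont_E: "continuous_on UNIV E"
  unfolding euler_deriv_def by (intro continuous_intros cont)

section \<open>Integrability of singular weights times test functions\<close>

lemma measurable_W [measurable]: "W \<in> borel_measurable borel"
  and measurable_l [measurable]: "\<l> \<in> borel_measurable borel"
  unfolding W_def[abs_def] \<l>_def[abs_def] by measurable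

text \<open>A continuous function is bounded on the compact set \<open>K\<close>, so the product is
  dominated by a multiple of \<open>\<rho> z powr (\<alpha> - 4)\<close> on the ball, with exponent
  above -2. The coefficient is controlled on \<open>K\<close> only, which admits powers of
  \<open>\<l>\<close>.\<close>

lemma integrable_coeff_bump:
  assumes u [measurable]: "u \<in> borel_measurable borel"
    and le: "\<And>z. z \<in> K \<Longrightarrow> \<bar>u z\<bar> \<le> C * \<rho> z powr (\<alpha> - 4)" and f: "bump f"
  shows "integrable lborel (\<lambda>z. u z * f z)"
proof -
  have [measurable]: "f \<in> borel_measurable borel"
    using f by (auto simp: bump_def intro: borel_measurable_continuous_onI)
  have "compact (f ` K)"
    using f K(1) by (intro compact_continuous_image) (auto simp: bump_def intro: continuous_on_subset)
  then obtain B where B: "\<And>z. z \<in> K \<Longrightarrow> \<bar>f z\<bar> \<le> B"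
    unfolding bounded_iff by (force dest!: compact_imp_bounded simp: bounded_iff)
  have int: "integrable lborel (\<lambda>z. C * B * (indicator (gball \<gamma> r) z * \<rho> z powr (\<alpha> - 4)))"
    using \<gamma> r \<alpha> by (intro integrable_mult_right integrable_gauge_powr) auto
  show ?thesis
  proof (rule Bochner_Integration.integrable_bound[OF int])
    show "AE z in lborel. norm (u z * f z) \<le> norm (C * B * (indicator (gball \<gamma> r) z * \<rho> z powr (\<alpha> - 4)))"
    proof (intro AE_I2)
      fix z
      show "norm (u z * f z) \<le> norm (C * B * (indicator (gball \<gamma> r) z * \<rho> z powr (\<alpha> - 4)))"
      proof (cases "z \<in> K")
        case True
        have "\<bar>u z\<bar> * \<bar>f z\<bar> \<le> (C * \<rho> z powr (\<alpha> - 4)) * B"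
          using le[OF True] B[OF True] by (intro mult_mono) auto
        also have "\<dots> \<le> \<bar>C * B * \<rho> z powr (\<alpha> - 4)\<bar>" by (simp add: mult_ac)
        finally show ?thesis using True K by (auto simp: abs_mult)
      qed (use f in \<open>auto simp: bump_def simp del: split_paired_All\<close>)
    qed
  qed measurable
qed

lemma powr_le_powr_diff:
  assumes "z \<in> K" "p \<ge> 0"
  shows "\<rho> z powr (\<alpha> - 4 + p) \<le> r powr p * \<rho> z powr (\<alpha> - 4)"
  using K_lt[OF assms(1)] assms(2) gauge_nonneg[of \<gamma> z]
  unfolding powr_add mult.commute[of "_ powr (\<alpha> - 4)"]
  by (intro mult_right_mono powr_mono2) auto

lemma W_le: "0 \<le> W z" "W z \<le> \<rho> z powr (\<alpha> - 4)"
  using grad_gauge_sq_bounds[OF \<gamma>, of z] by (auto simp: W_def mult_left_le)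

lemma integrable_x: "bump f \<Longrightarrow> integrable lborel (\<lambda>z. \<rho> z powr (\<alpha> - 2) * f z)"
  using powr_le_powr_diff[of _ 2] by (intro integrable_coeff_bump[where C = "r powr 2"]) auto

lemma integrable_y:
  "bump f \<Longrightarrow> integrable lborel (\<lambda>z. (norm (fst z) powr (2 * \<gamma>) * \<rho> z powr (\<alpha> - 2)) * f z)"
proof (rule integrable_coeff_bump[where C = "r powr (2 + 2 * \<gamma>)"])
  fix z assume z: "z \<in> K"
  have "norm (fst z) powr (2 * \<gamma>) \<le> \<rho> z powr (2 * \<gamma>)"
    using \<gamma> norm_fst_le_gauge[OF \<gamma>, of z] by (intro powr_mono2) auto
  then have "norm (fst z) powr (2 * \<gamma>) * \<rho> z powr (\<alpha> - 2) \<le> \<rho> z powr (2 * \<gamma>) * \<rho> z powr (\<alpha> - 2)"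
    by (intro mult_right_mono) auto
  also have "\<dots> = \<rho> z powr (\<alpha> - 4 + (2 + 2 * \<gamma>))"
    by (simp add: algebra_simps flip: powr_add)
  also have "\<dots> \<le> r powr (2 + 2 * \<gamma>) * \<rho> z powr (\<alpha> - 4)"
    using \<gamma> z by (intro powr_le_powr_diff) auto
  finally show "\<bar>norm (fst z) powr (2 * \<gamma>) * \<rho> z powr (\<alpha> - 2)\<bar> \<le> r powr (2 + 2 * \<gamma>) * \<rho> z powr (\<alpha> - 4)"
    by simp
qed measurable

lemma integrable_W: "bump f \<Longrightarrow> integrable lborel (\<lambda>z. W z * f z)"
  using W_le by (intro integrable_coeff_bump[where C = 1]) auto

text \<open>By compactness \<rho> attains a maximum below r on \<open>K\<close>, so ln(r / \<rho>)
  stays away from 0 there and \<open>\<l>\<close> is bounded.\<close>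

lemma integrable_Wl:
  assumes "bump f"
  shows "integrable lborel (\<lambda>z. (W z * \<l> z ^ n) * f z)"
proof -
  obtain M where M: "M > 0" "\<And>z. z \<in> K \<Longrightarrow> \<bar>\<l> z\<bar> \<le> M"
  proof (cases "K = {}")
    case False
    obtain z0 where z0: "z0 \<in> K" "\<And>z. z \<in> K \<Longrightarrow> \<rho> z \<le> \<rho> z0"
      using continuous_attains_sup[OF K(1) False continuous_on_subset[OF continuous_on_gauge[OF \<gamma>]]] by auto
    \<comment> \<open>The maximum with r / 2 keeps the divisor positive while it stays below
      r.\<close>
    have "\<bar>\<l> z\<bar> \<le> 1 / ln (r / max (\<rho> z0) (r / 2))" if "z \<in> K" for z
    proof (cases "\<rho> z = 0")
      case False
      then have pos: "\<rho> z > 0" using gauge_nonneg[of \<gamma> z] by simp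
      have m: "max (\<rho> z0) (r / 2) < r" "\<rho> z \<le> max (\<rho> z0) (r / 2)"
        using K_lt[OF z0(1)] z0(2)[OF that] r by auto
      have "0 < ln (r / max (\<rho> z0) (r / 2))" "ln (r / max (\<rho> z0) (r / 2)) \<le> ln (r / \<rho> z)"
        using m pos r by (auto intro!: divide_left_mono ln_gt_zero)
      then show ?thesis by (simp add: \<l>_def frac_le)
    qed (use K_lt[OF z0(1)] r in \<open>auto simp: \<l>_def\<close>)
    then show thesis
      by (intro that[of "max 1 (1 / ln (r / max (\<rho> z0) (r / 2)))"]) (auto simp: le_max_iff_disj)
  qed (use that[of 1] in auto)
  show ?thesis
  proof (rule integrable_coeff_bump[OF _ _ assms, where C = "M ^ n"])
    fix z assume "z \<in> K"
    then have "\<bar>W z\<bar> * \<bar>\<l> z\<bar> ^ n \<le> \<rho> z powr (\<alpha> - 4) * M ^ n"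
      using M W_le[of z] by (intro mult_mono power_mono) auto
    then show "\<bar>W z * \<l> z ^ n\<bar> \<le> M ^ n * \<rho> z powr (\<alpha> - 4)"
      by (simp add: abs_mult power_abs mult_ac)
  qed measurable
qed

section \<open>Integration by parts through translations\<close>

lemma W_eq:
  "\<rho> z powr (\<alpha> - 2 - 2 - 2 * \<gamma>) * norm (fst z) powr (2 * \<gamma>) = W z"
proof -
  have "\<rho> z powr (\<alpha> - 2 - 2 - 2 * \<gamma>) = \<rho> z powr (\<alpha> - 4) / \<rho> z powr (2 * \<gamma>)"
    by (simp flip: powr_diff)
  then show ?thesis by (simp add: W_def grad_gauge_sq_def)
qed

text \<open>The flow is translation along one x-axis, applied to \<open>?w\<close>. The weight
  \<open>W\<close> appears when the derivative falls on
  \<open>\<rho> z powr (\<alpha> - 2)\<close>.\<close>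

lemma integral_by_parts_x:
  "(\<integral>z. \<rho> z powr (\<alpha> - 2) * ((dx i \<phi> z)\<^sup>2 + \<phi> z * dx i (dx i \<phi>) z)
      + (\<alpha> - 2) * (W z * (fst z $ i * \<phi> z * dx i \<phi> z)) \<partial>lborel) = 0"
  (is "integral\<^sup>L _ ?g = 0")
proof (rule integral_flow_derivative_eq_0)
  let ?b = "(axis i 1, 0) :: (real^'m) \<times> (real^'k)"
  let ?w = "\<lambda>z. \<rho> z powr (\<alpha> - 2) * (\<phi> z * dx i \<phi> z)"
  show "continuous_on UNIV (\<lambda>p. snd p + fst p *\<^sub>R ?b)" by (intro continuous_intros)
  show "(\<integral>\<^sup>+z. ennreal 1 * h (z + s *\<^sub>R ?b) \<partial>lborel) = integral\<^sup>N lborel h"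
    if "h \<in> borel_measurable borel" for s and h :: "_ \<Rightarrow> ennreal"
    using nn_integral_translate[OF that] by simp
  show "integrable lborel ?w"
    by (intro integrable_x bump_mult bump_\<phi> cont)
  show "integrable lborel ?g"
    by (intro Bochner_Integration.integrable_add integrable_mult_right integrable_x integrable_W)
      (auto simp: bump_def dx_0 power2_eq_square intro!: continuous_intros cont)
  \<comment> \<open>Here \<alpha> > 2 is essential: the exponent \<alpha> - 2 is positive, so the
    power is continuous at the origin as well.\<close>
  have cw: "continuous_on UNIV ?w"
    using \<alpha> gauge_nonneg by (intro continuous_intros cont continuous_on_powr' continuous_on_gauge[OF \<gamma>]) auto
  have der: "((\<lambda>s. 1 * ?w (z + s *\<^sub>R ?b)) has_real_derivative 1 * ?g (z + s *\<^sub>R ?b)) (at s)"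
    if nz: "fst (z + s *\<^sub>R ?b) \<noteq> 0" for z s
  proof -
    let ?z = "z + s *\<^sub>R ?b"
    have "(?w has_derivative (\<lambda>h. \<rho> ?z powr (\<alpha> - 2) *
        (\<phi> ?z * frechet_derivative (dx i \<phi>) (at ?z) h + frechet_derivative \<phi> (at ?z) h * dx i \<phi> ?z) +
        ((\<alpha> - 2) * \<rho> ?z powr (\<alpha> - 2 - 2 - 2 * \<gamma>) *
       (norm (fst ?z) powr (2 * \<gamma>) * (fst ?z \<bullet> fst h) + (1 + \<gamma>) * (snd ?z \<bullet> snd h))) * (\<phi> ?z * dx i \<phi> ?z))) (at ?z)"
      by (intro has_derivative_mult gauge_powr_has_derivative[OF \<gamma> nz] differentiable[unfolded frechet_derivative_works])
    from has_real_derivative_along_line[OF this]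
    show ?thesis
      unfolding mult_1 W_eq[symmetric]
      by (rule DERIV_cong)
        (simp add: dx_def inner_axis algebra_simps power2_eq_square)
  qed
  \<comment> \<open>A line parallel to this axis meets x = 0 for at most one parameter, minus the
    i-th coordinate of x.\<close>
  have "finite {s. fst (z + s *\<^sub>R ?b) = 0}" for z :: "(real^'m) \<times> (real^'k)"
  proof (rule finite_subset)
    show "{s. fst (z + s *\<^sub>R ?b) = 0} \<subseteq> {- (fst z $ i)}"
      by (auto simp: vec_eq_iff axis_def dest!: spec[of _ i])
  qed simp
  moreover have "continuous_on {0..1} (\<lambda>s. ?w (z + s *\<^sub>R ?b))" for z
    by (intro continuous_on_compose2[OF cw] continuous_intros subset_UNIV)
  ultimately show "AE z in lborel. continuous_on {0..1} (\<lambda>s. 1 * ?w (z + s *\<^sub>R ?b)) \<and>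
          (\<exists>S. finite S \<and> (\<forall>s. s \<notin> S \<longrightarrow>
             ((\<lambda>s. 1 * ?w (z + s *\<^sub>R ?b)) has_real_derivative 1 * ?g (z + s *\<^sub>R ?b)) (at s)))"
    using der unfolding mult_1 by (intro AE_I2 conjI exI[of _ "{s. fst (_ + s *\<^sub>R ?b) = 0}"]) blast+
qed auto

text \<open>Translation in y fixes x, so the factor |x| to the power 2 \<gamma> is constant along
  the flow, and a line starting off x = 0 never meets that set. No exceptional times occur.\<close>

lemma integral_by_parts_y:
  "(\<integral>z. (norm (fst z) powr (2 * \<gamma>) * \<rho> z powr (\<alpha> - 2)) * ((dy j \<phi> z)\<^sup>2 + \<phi> z * dy j (dy j \<phi>) z)
      + (\<alpha> - 2) * (W z * ((1 + \<gamma>) * snd z $ j * \<phi> z * dy j \<phi> z)) \<partial>lborel) = 0"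
  (is "integral\<^sup>L _ ?g = 0")
proof (rule integral_flow_derivative_eq_0)
  let ?b = "(0, axis j 1) :: (real^'m) \<times> (real^'k)"
  let ?w = "\<lambda>z. (norm (fst z) powr (2 * \<gamma>) * \<rho> z powr (\<alpha> - 2)) * (\<phi> z * dy j \<phi> z)"
  let ?v = "\<lambda>z. \<rho> z powr (\<alpha> - 2) * (\<phi> z * dy j \<phi> z)"
  show "continuous_on UNIV (\<lambda>p. snd p + fst p *\<^sub>R ?b)" by (intro continuous_intros)
  show "(\<integral>\<^sup>+z. ennreal 1 * h (z + s *\<^sub>R ?b) \<partial>lborel) = integral\<^sup>N lborel h"
    if "h \<in> borel_measurable borel" for s and h :: "_ \<Rightarrow> ennreal"
    using nn_integral_translate[OF that] by simp
  show "integrable lborel ?w"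
    by (intro integrable_y bump_mult bump_\<phi> cont)
  show "integrable lborel ?g"
    by (intro Bochner_Integration.integrable_add integrable_mult_right integrable_y integrable_W)
      (auto simp: bump_def dy_0 power2_eq_square intro!: continuous_intros cont)
  have der: "((\<lambda>s. 1 * ?w (z + s *\<^sub>R ?b)) has_real_derivative 1 * ?g (z + s *\<^sub>R ?b)) (at s)"
    if nz: "fst z \<noteq> 0" for z s
  proof -
    let ?z = "z + s *\<^sub>R ?b"
    have nz': "fst ?z \<noteq> 0" using nz by simp
    have "(?v has_derivative (\<lambda>h. \<rho> ?z powr (\<alpha> - 2) *
        (\<phi> ?z * frechet_derivative (dy j \<phi>) (at ?z) h + frechet_derivative \<phi> (at ?z) h * dy j \<phi> ?z) +
        ((\<alpha> - 2) * \<rho> ?z powr (\<alpha> - 2 - 2 - 2 * \<gamma>) *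
       (norm (fst ?z) powr (2 * \<gamma>) * (fst ?z \<bullet> fst h) + (1 + \<gamma>) * (snd ?z \<bullet> snd h))) * (\<phi> ?z * dy j \<phi> ?z))) (at ?z)"
      by (intro has_derivative_mult gauge_powr_has_derivative[OF \<gamma> nz'] differentiable[unfolded frechet_derivative_works])
    from DERIV_cmult[OF has_real_derivative_along_line[OF this], of "norm (fst z) powr (2 * \<gamma>)"]
    have "((\<lambda>s. 1 * ?w (z + s *\<^sub>R ?b)) has_real_derivative norm (fst z) powr (2 * \<gamma>) * (\<rho> ?z powr (\<alpha> - 2) *
        (\<phi> ?z * frechet_derivative (dy j \<phi>) (at ?z) ?b + frechet_derivative \<phi> (at ?z) ?b * dy j \<phi> ?z) +
        ((\<alpha> - 2) * \<rho> ?z powr (\<alpha> - 2 - 2 - 2 * \<gamma>) *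
       (norm (fst ?z) powr (2 * \<gamma>) * (fst ?z \<bullet> fst ?b) + (1 + \<gamma>) * (snd ?z \<bullet> snd ?b))) * (\<phi> ?z * dy j \<phi> ?z))) (at s)"
      by (simp add: mult.assoc)
    then show ?thesis
      unfolding W_eq[symmetric]
      by (rule DERIV_cong)
        (simp add: dy_def inner_axis algebra_simps power2_eq_square)
  qed
  show "AE z in lborel. continuous_on {0..1} (\<lambda>s. 1 * ?w (z + s *\<^sub>R ?b)) \<and>
          (\<exists>S. finite S \<and> (\<forall>s. s \<notin> S \<longrightarrow>
             ((\<lambda>s. 1 * ?w (z + s *\<^sub>R ?b)) has_real_derivative 1 * ?g (z + s *\<^sub>R ?b)) (at s)))"
    using AE_fst_ne_0
  proof eventually_elim
    case (elim z)
    show ?case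
      using der[OF elim]
      by (intro conjI exI[of _ "{}"] DERIV_atLeastAtMost_imp_continuous_on) blast+
  qed
qed auto

text \<open>Along \<open>dil\<close> the Jacobian and the degree \<alpha> - 4 of \<open>W\<close>
  produce the coefficient Q + \<alpha> - 4, the square of \<open>\<phi>\<close> produces 2
  \<open>\<phi>\<close> \<open>E\<close>, and the radial factor produces \<rho> l'(\<rho>). A
  general \<open>l\<close> serves both the plain and the logarithmic weight.\<close>

lemma integral_dilation_identity:
  fixes l l' :: "real \<Rightarrow> real"
  assumes l: "\<And>t. 0 < t \<Longrightarrow> t < r \<Longrightarrow> (l has_real_derivative l' t) (at t)"
    and int: "integrable lborel (\<lambda>z. W z * l (\<rho> z) * (\<phi> z)\<^sup>2)"
      "integrable lborel (\<lambda>z. W z * (2 * (l (\<rho> z) * (\<phi> z * E z)) + (Q + \<alpha> - 4) * (l (\<rho> z) * (\<phi> z)\<^sup>2) + \<rho> z * l' (\<rho> z) * (\<phi> z)\<^sup>2))"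
  shows "(\<integral>z. W z * (2 * (l (\<rho> z) * (\<phi> z * E z)) + (Q + \<alpha> - 4) * (l (\<rho> z) * (\<phi> z)\<^sup>2) + \<rho> z * l' (\<rho> z) * (\<phi> z)\<^sup>2) \<partial>lborel) = 0"
    (is "integral\<^sup>L _ ?g = 0")
proof (rule integral_flow_derivative_eq_0[OF _ _ _ _ int])
  let ?w = "\<lambda>z. W z * l (\<rho> z) * (\<phi> z)\<^sup>2"
  show "continuous_on UNIV (\<lambda>p. dil \<gamma> (fst p) (snd p))"
    unfolding dil_def by (intro continuous_intros)
  show "(\<lambda>s. exp (Q * s)) \<in> borel_measurable borel" by measurable
  show "(\<integral>\<^sup>+z. ennreal (exp (Q * s)) * h (dil \<gamma> s z) \<partial>lborel) = integral\<^sup>N lborel h"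
    if "h \<in> borel_measurable borel" for s and h :: "(real^'m) \<times> (real^'k) \<Rightarrow> ennreal"
    unfolding Q by (rule nn_integral_dil[OF that])
  have der: "((\<lambda>s. exp (Q * s) * ?w (dil \<gamma> s z)) has_real_derivative exp (Q * s) * ?g (dil \<gamma> s z)) (at s)"
    if nz: "z \<noteq> 0" for z s
  proof (cases "dil \<gamma> s z \<in> K")
    case True
    define t where "t = exp s * \<rho> z"
    have t: "0 < t" "t < r"
      using K_lt[OF True] gauge_pos[OF \<gamma> nz] by (auto simp: t_def gauge_dil[OF \<gamma>])
    have dl: "((\<lambda>s. l (exp s * \<rho> z)) has_real_derivative l' t * t) (at s)"
      using l[OF t] unfolding t_def
      by (rule DERIV_chain2) (auto intro!: derivative_eq_intros)
    have W: "W (dil \<gamma> s z) = exp ((\<alpha> - 4) * s) * W z" for s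
      by (simp add: W_def gauge_dil[OF \<gamma>] grad_gauge_sq_dil[OF \<gamma>] powr_mult exp_powr_real mult.commute)
    have "((\<lambda>s. exp (Q * s) * (exp ((\<alpha> - 4) * s) * W z * l (exp s * \<rho> z) * (\<phi> (dil \<gamma> s z))\<^sup>2))
      has_real_derivative exp (Q * s) * (exp ((\<alpha> - 4) * s) * W z * (2 * (l t * (\<phi> (dil \<gamma> s z) * E (dil \<gamma> s z)))
         + (Q + \<alpha> - 4) * (l t * (\<phi> (dil \<gamma> s z))\<^sup>2) + t * l' t * (\<phi> (dil \<gamma> s z))\<^sup>2))) (at s)"
      by (auto intro!: derivative_eq_intros dl has_real_derivative_along_dil[OF differentiable(1)] simp: t_def[symmetric])
        (simp add: algebra_simps power2_eq_square)
    then show ?thesis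
      unfolding W gauge_dil[OF \<gamma>] t_def by (simp add: mult.assoc)
  next
    case False
    \<comment> \<open>Off \<open>K\<close> the product vanishes for all nearby times, so its
      derivative is 0 whatever \<open>l\<close> does at or beyond radius r.\<close>
    have "open ((\<lambda>s. dil \<gamma> s z) -` (- K))"
      using K(3) unfolding dil_def by (intro open_vimage continuous_intros) auto
    then have "eventually (\<lambda>s. s \<in> (\<lambda>s. dil \<gamma> s z) -` (- K)) (nhds s)"
      using False by (intro eventually_nhds_in_open) auto
    then have "eventually (\<lambda>s. exp (Q * s) * ?w (dil \<gamma> s z) = 0) (nhds s)"
      by eventually_elim (auto simp: \<phi>_0)
    then show ?thesis
      using False by (subst DERIV_cong_ev[OF refl _ refl, where g = "\<lambda>_. 0"]) (auto simp: \<phi>_0)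
  qed
  show "AE z in lborel. continuous_on {0..1} (\<lambda>s. exp (Q * s) * ?w (dil \<gamma> s z)) \<and>
          (\<exists>S. finite S \<and> (\<forall>s. s \<notin> S \<longrightarrow>
             ((\<lambda>s. exp (Q * s) * ?w (dil \<gamma> s z)) has_real_derivative exp (Q * s) * ?g (dil \<gamma> s z)) (at s)))"
    using AE_fst_ne_0
  proof eventually_elim
    case (elim z)
    then have "z \<noteq> 0" by auto
    from der[OF this] show ?case
      by (intro conjI exI[of _ "{}"] DERIV_atLeastAtMost_imp_continuous_on) blast+
  qed
qed auto

section \<open>Euler identities for the plain and the logarithmic weight\<close>

lemma bump_\<phi>_sq: "bump (\<lambda>z. (\<phi> z)\<^sup>2)"
  using bump_mult[OF bump_\<phi> cont(1)] by (simp add: power2_eq_square)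

lemma bump_\<phi>E: "bump (\<lambda>z. \<phi> z * E z)"
  by (intro bump_mult bump_\<phi> cont_E)

lemma dilation_identity:
  "2 * (\<integral>z. W z * (\<phi> z * E z) \<partial>lborel) + (Q + \<alpha> - 4) * (\<integral>z. W z * (\<phi> z)\<^sup>2 \<partial>lborel) = 0"
proof -
  note int = integrable_W[OF bump_\<phi>_sq] integrable_W[OF bump_\<phi>E]
  have eq: "(\<lambda>z. W z * (2 * (1 * (\<phi> z * E z)) + (Q + \<alpha> - 4) * (1 * (\<phi> z)\<^sup>2) + \<rho> z * 0 * (\<phi> z)\<^sup>2))
     = (\<lambda>z. 2 * (W z * (\<phi> z * E z)) + (Q + \<alpha> - 4) * (W z * (\<phi> z)\<^sup>2))"
    by (simp add: fun_eq_iff algebra_simps)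
  have "(\<integral>z. W z * (2 * (1 * (\<phi> z * E z)) + (Q + \<alpha> - 4) * (1 * (\<phi> z)\<^sup>2) + \<rho> z * 0 * (\<phi> z)\<^sup>2) \<partial>lborel) = 0"
    using int by (intro integral_dilation_identity[of "\<lambda>_. 1" "\<lambda>_. 0"]) (auto simp only: eq mult_1_right intro!: Bochner_Integration.integrable_add integrable_mult_right DERIV_const)
  then show ?thesis
    unfolding eq using int by simp
qed

text \<open>For l(t) = 1 / ln(r / t) one has t l'(t) = l(t)^2, the source of the last term. The
  exponent 1 is kept explicit so that the integrands match \<open>integrable_Wl\<close>.\<close>

lemma log_dilation_identity:
  "2 * (\<integral>z. W z * \<l> z ^ 1 * (\<phi> z * E z) \<partial>lborel) + (Q + \<alpha> - 4) * (\<integral>z. W z * \<l> z ^ 1 * (\<phi> z)\<^sup>2 \<partial>lborel)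
    + (\<integral>z. W z * \<l> z ^ 2 * (\<phi> z)\<^sup>2 \<partial>lborel) = 0"
proof -
  note int = integrable_Wl[OF bump_\<phi>_sq, of 1] integrable_Wl[OF bump_\<phi>E, of 1] integrable_Wl[OF bump_\<phi>_sq, of 2]
  let ?l = "\<lambda>t. 1 / ln (r / t)" and ?l' = "\<lambda>t. 1 / (t * (ln (r / t))\<^sup>2)"
  have eq: "(\<lambda>z. W z * (2 * (?l (\<rho> z) * (\<phi> z * E z)) + (Q + \<alpha> - 4) * (?l (\<rho> z) * (\<phi> z)\<^sup>2) + \<rho> z * ?l' (\<rho> z) * (\<phi> z)\<^sup>2))
     = (\<lambda>z. 2 * (W z * \<l> z ^ 1 * (\<phi> z * E z)) + (Q + \<alpha> - 4) * (W z * \<l> z ^ 1 * (\<phi> z)\<^sup>2) + W z * \<l> z ^ 2 * (\<phi> z)\<^sup>2)"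
    (is "?L = ?R")
  proof
    fix z
    show "?L z = ?R z"
      \<comment> \<open>At \<rho> = 0 the weight \<open>W\<close> is 0, so both sides vanish;
        elsewhere \<rho> cancels against the t in the denominator of \<open>?l'\<close>.\<close>
      by (cases "\<rho> z = 0") (simp_all add: \<l>_def W_def power_divide algebra_simps)
  qed
  have "integral\<^sup>L lborel ?L = 0"
  proof (rule integral_dilation_identity[of ?l ?l'])
    show "(?l has_real_derivative ?l' t) (at t)" if "0 < t" "t < r" for t
    proof -
      have "ln (r / t) \<noteq> 0" using that ln_gt_zero[of "r / t"] by auto
      then show ?thesis
        using that r by (auto intro!: derivative_eq_intros simp: field_simps power2_eq_square)
    qed
    show "integrable lborel (\<lambda>z. W z * ?l (\<rho> z) * (\<phi> z)\<^sup>2)"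
      using int(1) by (simp add: \<l>_def)
    show "integrable lborel ?L"
      unfolding eq using int by (intro Bochner_Integration.integrable_add integrable_mult_right) auto
  qed
  then show ?thesis
    unfolding eq using int by (simp del: power_one_right)
qed

text \<open>Summing the coordinate identities over all directions collects the squares into
  \<open>grad_sq\<close>, the second derivatives into \<open>grushin\<close>, and the first-order
  terms with weight \<open>W\<close> into \<open>E\<close>.\<close>

lemma integrable_grad_sq: "integrable lborel (\<lambda>z. \<rho> z powr (\<alpha> - 2) * grad_sq \<gamma> \<phi> z)"
  and integrable_grushin: "integrable lborel (\<lambda>z. \<rho> z powr (\<alpha> - 2) * (\<phi> z * grushin \<gamma> \<phi> z))"
  and integral_by_parts:
    "(\<integral>z. \<rho> z powr (\<alpha> - 2) * grad_sq \<gamma> \<phi> z \<partial>lborel)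
      + (\<integral>z. \<rho> z powr (\<alpha> - 2) * (\<phi> z * grushin \<gamma> \<phi> z) \<partial>lborel)
      + (\<alpha> - 2) * (\<integral>z. W z * (\<phi> z * E z) \<partial>lborel) = 0"
proof -
  let ?n = "\<lambda>z::(real^'m) \<times> (real^'k). norm (fst z) powr (2 * \<gamma>)"
  let ?gx = "\<lambda>i z. \<rho> z powr (\<alpha> - 2) * ((dx i \<phi> z)\<^sup>2 + \<phi> z * dx i (dx i \<phi>) z)
      + (\<alpha> - 2) * (W z * (fst z $ i * \<phi> z * dx i \<phi> z))"
  let ?gy = "\<lambda>j z. (?n z * \<rho> z powr (\<alpha> - 2)) * ((dy j \<phi> z)\<^sup>2 + \<phi> z * dy j (dy j \<phi>) z)
      + (\<alpha> - 2) * (W z * ((1 + \<gamma>) * snd z $ j * \<phi> z * dy j \<phi> z))"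
  have bumps: "bump (\<lambda>z. \<Sum>i\<in>UNIV. (dx i \<phi> z)\<^sup>2)" "bump (\<lambda>z. \<phi> z * (\<Sum>i\<in>UNIV. dx i (dx i \<phi>) z))"
      "bump (\<lambda>z. \<Sum>j\<in>UNIV. (dy j \<phi> z)\<^sup>2)" "bump (\<lambda>z. \<phi> z * (\<Sum>j\<in>UNIV. dy j (dy j \<phi>) z))"
    unfolding power2_eq_square
    by (intro bump_sum bump_mult bump_\<phi> bump_dx bump_dy continuous_intros cont)+
  show ig: "integrable lborel (\<lambda>z. \<rho> z powr (\<alpha> - 2) * grad_sq \<gamma> \<phi> z)"
    using Bochner_Integration.integrable_add[OF integrable_x[OF bumps(1)] integrable_y[OF bumps(3)]]
    by (simp add: grad_sq_def algebra_simps)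
  show ip: "integrable lborel (\<lambda>z. \<rho> z powr (\<alpha> - 2) * (\<phi> z * grushin \<gamma> \<phi> z))"
    using Bochner_Integration.integrable_add[OF integrable_x[OF bumps(2)] integrable_y[OF bumps(4)]]
    by (simp add: grushin_def algebra_simps)
  have intx: "integrable lborel (?gx i)" for i
    by (intro Bochner_Integration.integrable_add integrable_mult_right integrable_x integrable_W)
      (auto simp: bump_def dx_0 power2_eq_square intro!: continuous_intros cont)
  have inty: "integrable lborel (?gy j)" for j
    by (intro Bochner_Integration.integrable_add integrable_mult_right integrable_y integrable_W)
      (auto simp: bump_def dy_0 power2_eq_square intro!: continuous_intros cont)
  have eq: "(\<Sum>i\<in>UNIV. ?gx i z) + (\<Sum>j\<in>UNIV. ?gy j z) = \<rho> z powr (\<alpha> - 2) * grad_sq \<gamma> \<phi> z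
      + \<rho> z powr (\<alpha> - 2) * (\<phi> z * grushin \<gamma> \<phi> z) + (\<alpha> - 2) * (W z * (\<phi> z * E z))" for z
  proof -
    \<comment> \<open>Naming \<alpha> - 2 and 1 + \<gamma> keeps \<open>algebra_simps\<close> from
      multiplying them out.\<close>
    define b c where "b = \<alpha> - 2" and "c = 1 + \<gamma>"
    show ?thesis
      unfolding grad_sq_def grushin_def euler_deriv_def b_def[symmetric] c_def[symmetric]
      by (simp only: algebra_simps sum.distrib sum_distrib_left sum_distrib_right)
  qed
  have "0 = (\<Sum>i\<in>UNIV. integral\<^sup>L lborel (?gx i)) + (\<Sum>j\<in>UNIV. integral\<^sup>L lborel (?gy j))"
    by (simp only: integral_by_parts_x integral_by_parts_y sum.neutral_const)
  also have "\<dots> = (\<integral>z. (\<Sum>i\<in>UNIV. ?gx i z) + (\<Sum>j\<in>UNIV. ?gy j z) \<partial>lborel)"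
    using intx inty
    by (subst Bochner_Integration.integral_add) (simp_all only: Bochner_Integration.integral_sum Bochner_Integration.integrable_sum)
  finally show "(\<integral>z. \<rho> z powr (\<alpha> - 2) * grad_sq \<gamma> \<phi> z \<partial>lborel)
      + (\<integral>z. \<rho> z powr (\<alpha> - 2) * (\<phi> z * grushin \<gamma> \<phi> z) \<partial>lborel)
      + (\<alpha> - 2) * (\<integral>z. W z * (\<phi> z * E z) \<partial>lborel) = 0"
    unfolding eq using ig ip integrable_W[OF bump_\<phi>E] by simp
qed

section \<open>Hardy and Rellich inequalities\<close>

text \<open>This is the expanded square of the Grushin gradient of \<open>\<phi>\<close> plus a
  \<open>\<phi>\<close> times that of \<rho>, divided by \<rho>, with weight
  \<open>\<rho> z powr (\<alpha> - 2)\<close>. Being pointwise, it allows \<open>a\<close> to depend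
  on \<open>z\<close>.\<close>

lemma square_nonneg:
  "0 \<le> \<rho> z powr (\<alpha> - 2) * grad_sq \<gamma> \<phi> z + 2 * a * (W z * (\<phi> z * E z)) + a\<^sup>2 * (W z * (\<phi> z)\<^sup>2)"
proof (cases "z = 0")
  case False
  define \<kappa> where "\<kappa> = \<rho> z powr (- 2 - 2 * \<gamma>)"
  define n where "n = norm (fst z) powr (2 * \<gamma>)"
  have \<rho>: "\<rho> z > 0" using gauge_pos[OF \<gamma> False] .
  have W: "W z = \<rho> z powr (\<alpha> - 2) * (\<kappa> * n)"
  proof -
    have "\<rho> z powr (\<alpha> - 4) / \<rho> z powr (2 * \<gamma>) = \<rho> z powr (\<alpha> - 2) * \<kappa>"
    proof -
      have "\<alpha> - 4 - 2 * \<gamma> = \<alpha> - 2 + (- 2 - 2 * \<gamma>)" by simp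
      then show ?thesis by (simp only: \<kappa>_def powr_diff[symmetric] powr_add[symmetric])
    qed
    moreover have "W z = \<rho> z powr (\<alpha> - 4) / \<rho> z powr (2 * \<gamma>) * n"
      by (simp add: W_def grad_gauge_sq_def n_def)
    ultimately show ?thesis by (simp only: mult.assoc)
  qed
  have nn: "n * (norm (fst z))\<^sup>2 = norm (fst z) powr (2 * (1 + \<gamma>))"
    unfolding n_def by (cases "fst z = 0") (simp_all add: algebra_simps powr_add)
  have "\<kappa> * \<rho> z powr (2 * (1 + \<gamma>)) = \<rho> z powr 0"
    unfolding \<kappa>_def by (simp flip: powr_add)
  \<comment> \<open>The defining equation of the gauge. It turns the quadratic term into a single
    factor \<open>\<kappa> * n\<close>, which is \<open>grad_gauge_sq \<gamma> z\<close> divided by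
    the square of \<rho>.\<close>
  then have \<kappa>: "\<kappa> * (n * (norm (fst z))\<^sup>2 + (1 + \<gamma>)\<^sup>2 * (norm (snd z))\<^sup>2) = 1"
    unfolding nn gauge_powr[OF \<gamma>, symmetric] using \<rho> by simp
  have x: "(norm x)\<^sup>2 = (\<Sum>i\<in>UNIV. (x $ i)\<^sup>2)" for x :: "real^'n::finite"
    by (simp add: norm_eq_sqrt_inner inner_vec_def power2_eq_square sum_nonneg)
  have "0 \<le> (\<Sum>i\<in>UNIV. (dx i \<phi> z + a * \<phi> z * \<kappa> * n * fst z $ i)\<^sup>2)
      + n * (\<Sum>j\<in>UNIV. (dy j \<phi> z + a * \<phi> z * \<kappa> * (1 + \<gamma>) * snd z $ j)\<^sup>2)"
    by (simp add: sum_nonneg n_def)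
  also have "\<dots> = grad_sq \<gamma> \<phi> z + 2 * a * (\<kappa> * n * (\<phi> z * E z))
      + a\<^sup>2 * \<kappa> * n * (\<phi> z)\<^sup>2 * (\<kappa> * (n * (norm (fst z))\<^sup>2 + (1 + \<gamma>)\<^sup>2 * (norm (snd z))\<^sup>2))"
  proof -
    define c where "c = 1 + \<gamma>"
    show ?thesis
      unfolding grad_sq_def euler_deriv_def x n_def[symmetric] c_def[symmetric]
      by (simp add: power2_eq_square algebra_simps sum.distrib sum_distrib_left sum_distrib_right)
  qed
  finally have "0 \<le> \<rho> z powr (\<alpha> - 2) * (grad_sq \<gamma> \<phi> z + 2 * a * (\<kappa> * n * (\<phi> z * E z)) + a\<^sup>2 * \<kappa> * n * (\<phi> z)\<^sup>2)"
    unfolding \<kappa> by simp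
  then show ?thesis unfolding W by (simp add: algebra_simps)
next
  case True
  then have "\<rho> z = 0" by (simp add: gauge_eq_0_iff[OF \<gamma>])
  then show ?thesis by (simp add: W_def)
qed

lemma hardy_log:
  defines "A \<equiv> (Q + \<alpha> - 4) / 2"
  shows "A\<^sup>2 * (\<integral>z. W z * (\<phi> z)\<^sup>2 \<partial>lborel) + (\<integral>z. W z * \<l> z ^ 2 * (\<phi> z)\<^sup>2 \<partial>lborel) / 4
     \<le> (\<integral>z. \<rho> z powr (\<alpha> - 2) * grad_sq \<gamma> \<phi> z \<partial>lborel)"
proof -
  note int = integrable_grad_sq integrable_W[OF bump_\<phi>E] integrable_W[OF bump_\<phi>_sq]
    integrable_Wl[OF bump_\<phi>_sq, of 1] integrable_Wl[OF bump_\<phi>E, of 1] integrable_Wl[OF bump_\<phi>_sq, of 2]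
  let ?f = "\<lambda>z. \<rho> z powr (\<alpha> - 2) * grad_sq \<gamma> \<phi> z + 2 * A * (W z * (\<phi> z * E z))
      + W z * \<l> z ^ 1 * (\<phi> z * E z) + A\<^sup>2 * (W z * (\<phi> z)\<^sup>2) + A * (W z * \<l> z ^ 1 * (\<phi> z)\<^sup>2)
      + 1 / 4 * (W z * \<l> z ^ 2 * (\<phi> z)\<^sup>2)"
  have "0 \<le> ?f z" for z
    \<comment> \<open>A is the optimal constant for the plain Hardy inequality; the correction
      \<open>\<l> z / 2\<close> produces the logarithmic remainder.\<close>
    using square_nonneg[of z "A + \<l> z / 2"] by (simp add: algebra_simps power2_eq_square)
  then have "0 \<le> integral\<^sup>L lborel ?f"
    by (rule Bochner_Integration.integral_nonneg)
  also have "\<dots> = (\<integral>z. \<rho> z powr (\<alpha> - 2) * grad_sq \<gamma> \<phi> z \<partial>lborel) + 2 * A * (\<integral>z. W z * (\<phi> z * E z) \<partial>lborel)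
      + (\<integral>z. W z * \<l> z ^ 1 * (\<phi> z * E z) \<partial>lborel) + A\<^sup>2 * (\<integral>z. W z * (\<phi> z)\<^sup>2 \<partial>lborel)
      + A * (\<integral>z. W z * \<l> z ^ 1 * (\<phi> z)\<^sup>2 \<partial>lborel) + 1 / 4 * (\<integral>z. W z * \<l> z ^ 2 * (\<phi> z)\<^sup>2 \<partial>lborel)"
    using int
    by (simp only: Bochner_Integration.integral_add Bochner_Integration.integrable_add integrable_mult_right integral_mult_right_zero simp_thms)
  finally have "0 \<le> \<dots>" .
  moreover have "(\<integral>z. W z * (\<phi> z * E z) \<partial>lborel) = - A * (\<integral>z. W z * (\<phi> z)\<^sup>2 \<partial>lborel)"
    using dilation_identity by (simp add: A_def field_simps)
  moreover have "(\<integral>z. W z * \<l> z ^ 1 * (\<phi> z * E z) \<partial>lborel)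
      = - A * (\<integral>z. W z * \<l> z ^ 1 * (\<phi> z)\<^sup>2 \<partial>lborel) - (\<integral>z. W z * \<l> z ^ 2 * (\<phi> z)\<^sup>2 \<partial>lborel) / 2"
    using log_dilation_identity by (simp add: A_def field_simps del: power_one_right)
  \<comment> \<open>The two terms containing \<open>\<l>\<close> to the first power and the square
    of \<open>\<phi>\<close> cancel. The integral with \<open>\<l>\<close> squared occurs with -1/2
    from the Euler identity and +1/4 from the square, leaving -1/4.\<close>
  ultimately show ?thesis
    by (simp add: power2_eq_square algebra_simps del: power_one_right)
qed

lemma rellich_lower_bound:
  assumes "\<alpha> < Q"
  defines "A \<equiv> (Q + \<alpha> - 4) / 2"
  defines "\<epsilon> \<equiv> A * (Q - \<alpha>) / 4"
  shows "(Q - \<alpha>)\<^sup>2 / 4 * (\<integral>z. \<rho> z powr (\<alpha> - 2) * grad_sq \<gamma> \<phi> z \<partial>lborel)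
      + (Q - \<alpha>) * (Q + 3 * \<alpha> - 8) / 16 * (\<integral>z. W z * \<l> z ^ 2 * (\<phi> z)\<^sup>2 \<partial>lborel)
     \<le> (\<integral>z. - 4 * \<epsilon> * (\<rho> z powr (\<alpha> - 2) * (\<phi> z * grushin \<gamma> \<phi> z)) - 4 * \<epsilon>\<^sup>2 * (W z * (\<phi> z)\<^sup>2) \<partial>lborel)"
proof -
  define G where "G = (\<integral>z. \<rho> z powr (\<alpha> - 2) * grad_sq \<gamma> \<phi> z \<partial>lborel)"
  define P where "P = (\<integral>z. \<rho> z powr (\<alpha> - 2) * (\<phi> z * grushin \<gamma> \<phi> z) \<partial>lborel)"
  define X where "X = (\<integral>z. W z * (\<phi> z * E z) \<partial>lborel)"
  define H where "H = (\<integral>z. W z * (\<phi> z)\<^sup>2 \<partial>lborel)"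
  define L where "L = (\<integral>z. W z * \<l> z ^ 2 * (\<phi> z)\<^sup>2 \<partial>lborel)"
  \<comment> \<open>In terms of \<delta> and \<beta> everything is polynomial: A = \<delta> +
    \<beta>, \<epsilon> = A \<delta> / 2, and the target coefficients are \<delta>^2 and \<delta>
    (\<delta> + 2 \<beta>) / 4.\<close>
  define \<delta> where "\<delta> = (Q - \<alpha>) / 2"
  define \<beta> where "\<beta> = \<alpha> - 2"
  have pos: "\<delta> > 0" "\<beta> > 0" using assms \<alpha> by (auto simp: \<delta>_def \<beta>_def)
  have A: "A = \<delta> + \<beta>" by (simp add: A_def \<delta>_def \<beta>_def field_simps)
  have \<epsilon>: "\<epsilon> = A * \<delta> / 2" by (simp add: \<epsilon>_def \<delta>_def)
  have "G + P + \<beta> * X = 0"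
    using integral_by_parts by (simp add: G_def P_def X_def \<beta>_def)
  moreover have "X = - A * H"
    using dilation_identity by (simp add: X_def H_def A_def field_simps)
  ultimately have P: "P = \<beta> * A * H - G" by simp
  have hardy: "A\<^sup>2 * H \<le> G - L / 4"
    using hardy_log by (simp add: G_def H_def L_def A_def)
  \<comment> \<open>The regrouping isolates G - L / 4, the side of the Hardy inequality that
    dominates A^2 H. Its coefficient is negative, so inserting the Hardy bound enlarges the
    expression.\<close>
  have "\<delta>\<^sup>2 * G + \<delta> * (\<delta> + 2 * \<beta>) / 4 * L = 2 * \<delta> * A * G - 2 * \<delta> * (\<beta> + \<delta> / 2) * (G - L / 4)"
    by (simp add: A field_simps power2_eq_square)
  also have "\<dots> \<le> 2 * \<delta> * A * G - 2 * \<delta> * (\<beta> + \<delta> / 2) * (A\<^sup>2 * H)"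
    using hardy pos by (intro diff_left_mono mult_left_mono) auto
  also have "\<dots> = - 4 * \<epsilon> * P - 4 * \<epsilon>\<^sup>2 * H"
    unfolding P \<epsilon> by (simp add: field_simps power2_eq_square)
  also have "\<dots> = (\<integral>z. - 4 * \<epsilon> * (\<rho> z powr (\<alpha> - 2) * (\<phi> z * grushin \<gamma> \<phi> z)) - 4 * \<epsilon>\<^sup>2 * (W z * (\<phi> z)\<^sup>2) \<partial>lborel)"
    unfolding P_def H_def using integrable_grushin integrable_W[OF bump_\<phi>_sq]
    by (subst Bochner_Integration.integral_diff) auto
  finally have "\<delta>\<^sup>2 * G + \<delta> * (\<delta> + 2 * \<beta>) / 4 * L \<le> \<dots>" .
  moreover have "\<delta>\<^sup>2 = (Q - \<alpha>)\<^sup>2 / 4" "\<delta> * (\<delta> + 2 * \<beta>) / 4 = (Q - \<alpha>) * (Q + 3 * \<alpha> - 8) / 16"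
    by (simp_all add: \<delta>_def \<beta>_def power_divide field_simps)
  ultimately show ?thesis unfolding G_def L_def by simp
qed

text \<open>Completing the square in \<rho>^2 \<open>D\<close> + 2 \<epsilon> g
  \<open>\<phi>\<close>, with weight \<open>\<rho> z powr (\<alpha> - 4) / g\<close>. On x = 0 the
  quotient on the right would be 0 by the convention for division, hence the exclusion.\<close>

lemma young_pointwise:
  assumes "fst z \<noteq> 0"
  shows "- 4 * \<epsilon> * (\<rho> z powr (\<alpha> - 2) * (\<phi> z * grushin \<gamma> \<phi> z)) - 4 * \<epsilon>\<^sup>2 * (W z * (\<phi> z)\<^sup>2)
    \<le> \<rho> z powr \<alpha> * (grushin \<gamma> \<phi> z)\<^sup>2 / grad_gauge_sq \<gamma> z"
proof -
  have "z \<noteq> 0" using assms by auto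
  then have \<rho>: "\<rho> z > 0" by (rule gauge_pos[OF \<gamma>])
  define g where "g = grad_gauge_sq \<gamma> z"
  define D where "D = grushin \<gamma> \<phi> z"
  have g: "g > 0" using assms \<rho> by (simp add: g_def grad_gauge_sq_def)
  have p: "\<rho> z powr \<alpha> = \<rho> z powr (\<alpha> - 4) * \<rho> z ^ 4" "\<rho> z powr (\<alpha> - 2) = \<rho> z powr (\<alpha> - 4) * \<rho> z ^ 2"
    using \<rho> by (simp_all add: powr_diff)
      (simp add: field_simps power4_eq_xxxx power2_eq_square)
  have "0 \<le> \<rho> z powr (\<alpha> - 4) * (\<rho> z ^ 2 * D + 2 * \<epsilon> * g * \<phi> z)\<^sup>2 / g"
    using g by simp
  also have "\<dots> = \<rho> z powr \<alpha> * D\<^sup>2 / g + 4 * \<epsilon> * (\<rho> z powr (\<alpha> - 2) * (\<phi> z * D)) + 4 * \<epsilon>\<^sup>2 * (W z * (\<phi> z)\<^sup>2)"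
    unfolding p W_def g_def[symmetric] using g by (simp add: field_simps power2_eq_square power4_eq_xxxx)
  finally show ?thesis by (simp add: g_def D_def)
qed

text \<open>Both integrals on the smaller side are finite and become Bochner integrals, where
  \<open>rellich_lower_bound\<close> applies. The larger side stays a nonnegative integral, so the
  value infinity is covered.\<close>

lemma rellich_log:
  assumes "\<alpha> < Q"
  shows "(\<integral>\<^sup>+ z. indicator (gball \<gamma> r) z *
            ennreal (gauge \<gamma> z powr \<alpha> * (grushin \<gamma> \<phi> z)\<^sup>2 / grad_gauge_sq \<gamma> z) \<partial>lborel)
    \<ge> ennreal ((Q - \<alpha>)\<^sup>2 / 4) *
          (\<integral>\<^sup>+ z. indicator (gball \<gamma> r) z *
            ennreal (gauge \<gamma> z powr \<alpha> * grad_sq \<gamma> \<phi> z / (gauge \<gamma> z)\<^sup>2) \<partial>lborel)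
      + ennreal ((Q - \<alpha>) * (Q + 3*\<alpha> - 8) / 16) *
          (\<integral>\<^sup>+ z. indicator (gball \<gamma> r) z *
            ennreal (gauge \<gamma> z powr (\<alpha> - 4) * grad_gauge_sq \<gamma> z * (\<phi> z)\<^sup>2
                     / (ln (r / gauge \<gamma> z))\<^sup>2) \<partial>lborel)"
proof -
  let ?G = "\<lambda>z. \<rho> z powr (\<alpha> - 2) * grad_sq \<gamma> \<phi> z" and ?L = "\<lambda>z. W z * \<l> z ^ 2 * (\<phi> z)\<^sup>2"
  define \<epsilon> where "\<epsilon> = (Q + \<alpha> - 4) / 2 * (Q - \<alpha>) / 4"
  let ?f = "\<lambda>z. - 4 * \<epsilon> * (\<rho> z powr (\<alpha> - 2) * (\<phi> z * grushin \<gamma> \<phi> z)) - 4 * \<epsilon>\<^sup>2 * (W z * (\<phi> z)\<^sup>2)"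
  have ball: "z \<in> gball \<gamma> r \<or> z \<notin> K" for z using K(2) by auto
  have gs: "grad_sq \<gamma> \<phi> z \<ge> 0" for z by (auto simp: grad_sq_def intro!: add_nonneg_nonneg mult_nonneg_nonneg sum_nonneg)
  have "\<rho> z powr \<alpha> / (\<rho> z)\<^sup>2 = \<rho> z powr (\<alpha> - 2)" for z
    using gauge_nonneg[of \<gamma> z] by (cases "\<rho> z = 0") (auto simp: powr_diff)
  then have "(\<integral>\<^sup>+ z. indicator (gball \<gamma> r) z * ennreal (\<rho> z powr \<alpha> * grad_sq \<gamma> \<phi> z / (\<rho> z)\<^sup>2) \<partial>lborel)
      = (\<integral>\<^sup>+ z. ennreal (?G z) \<partial>lborel)"
    \<comment> \<open>Derivatives of \<open>\<phi>\<close> vanish off \<open>K\<close>, which lies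
      in the ball, so the indicator may be dropped.\<close>
    using ball by (intro nn_integral_cong) (force simp: indicator_def grad_sq_def dx_0 dy_0 simp flip: times_divide_eq_left)
  also have "\<dots> = ennreal (integral\<^sup>L lborel ?G)"
    using gs by (intro nn_integral_eq_integral integrable_grad_sq) auto
  finally have G: "(\<integral>\<^sup>+ z. indicator (gball \<gamma> r) z * ennreal (\<rho> z powr \<alpha> * grad_sq \<gamma> \<phi> z / (\<rho> z)\<^sup>2) \<partial>lborel)
      = ennreal (integral\<^sup>L lborel ?G)" .
  have "(\<integral>\<^sup>+ z. indicator (gball \<gamma> r) z * ennreal (\<rho> z powr (\<alpha> - 4) * grad_gauge_sq \<gamma> z * (\<phi> z)\<^sup>2 / (ln (r / \<rho> z))\<^sup>2) \<partial>lborel)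
      = (\<integral>\<^sup>+ z. ennreal (?L z) \<partial>lborel)"
    using ball \<phi>_0 by (intro nn_integral_cong) (force simp: indicator_def W_def \<l>_def power_divide)
  also have "\<dots> = ennreal (integral\<^sup>L lborel ?L)"
    using W_le by (intro nn_integral_eq_integral integrable_Wl bump_\<phi>_sq) auto
  finally have L: "(\<integral>\<^sup>+ z. indicator (gball \<gamma> r) z * ennreal (\<rho> z powr (\<alpha> - 4) * grad_gauge_sq \<gamma> z * (\<phi> z)\<^sup>2 / (ln (r / \<rho> z))\<^sup>2) \<partial>lborel)
      = ennreal (integral\<^sup>L lborel ?L)" .
  have "0 \<le> integral\<^sup>L lborel ?G" "0 \<le> integral\<^sup>L lborel ?L"
    using gs W_le by (auto intro!: Bochner_Integration.integral_nonneg)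
  \<comment> \<open>Q > \<alpha> > 2 gives Q + 3 \<alpha> - 8 > 4 (\<alpha> - 2) > 0, so
    \<open>ennreal\<close> does not truncate the constant.\<close>
  moreover have "0 \<le> (Q - \<alpha>) * (Q + 3*\<alpha> - 8) / 16" using assms \<alpha> by simp
  ultimately have "ennreal ((Q - \<alpha>)\<^sup>2 / 4) * ennreal (integral\<^sup>L lborel ?G) + ennreal ((Q - \<alpha>) * (Q + 3*\<alpha> - 8) / 16) * ennreal (integral\<^sup>L lborel ?L)
    = ennreal ((Q - \<alpha>)\<^sup>2 / 4 * integral\<^sup>L lborel ?G + (Q - \<alpha>) * (Q + 3*\<alpha> - 8) / 16 * integral\<^sup>L lborel ?L)"
    by (subst ennreal_plus) (simp_all only: ennreal_mult'' mult_nonneg_nonneg divide_nonneg_nonneg zero_le_power2 zero_le_numeral)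
  also have "\<dots> \<le> ennreal (integral\<^sup>L lborel ?f)"
    unfolding \<epsilon>_def by (intro ennreal_leI rellich_lower_bound assms)
  \<comment> \<open>\<open>?f\<close> may change sign; discarding its negative part only increases
    the integral.\<close>
  also have "\<dots> \<le> (\<integral>\<^sup>+ z. ennreal (?f z) \<partial>lborel)"
    using integrable_grushin integrable_W[OF bump_\<phi>_sq]
    by (intro ennreal_integral_le_nn_integral Bochner_Integration.integrable_diff integrable_mult_right)
  also have "\<dots> \<le> (\<integral>\<^sup>+ z. indicator (gball \<gamma> r) z *
            ennreal (\<rho> z powr \<alpha> * (grushin \<gamma> \<phi> z)\<^sup>2 / grad_gauge_sq \<gamma> z) \<partial>lborel)"
  proof (rule nn_integral_mono_AE)
    show "AE z in lborel. ennreal (?f z) \<le> indicator (gball \<gamma> r) z *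
            ennreal (\<rho> z powr \<alpha> * (grushin \<gamma> \<phi> z)\<^sup>2 / grad_gauge_sq \<gamma> z)"
      using AE_fst_ne_0
    proof eventually_elim
      case (elim z)
      show ?case
      proof (cases "z \<in> gball \<gamma> r")
        case True
        then show ?thesis using young_pointwise[OF elim] by (simp add: ennreal_leI)
      next
        case False
        then have "\<phi> z = 0" using ball \<phi>_0 by blast
        then show ?thesis by simp
      qed
    qed
  qed
  finally show ?thesis unfolding G L .
qed

end

theorem theorem4p8:
  fixes \<gamma> \<alpha> r :: real and \<phi> :: "(real^'m::finite) \<times> (real^'k::finite) \<Rightarrow> real"
  defines "Q \<equiv> hom_dim \<gamma> TYPE('m) TYPE('k)"
  assumes "\<gamma> > 0" and "2 < \<alpha>" and "\<alpha> < Q" and "r > 0"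
    and "\<phi> \<in> C0_infty (gball \<gamma> r)"
  shows "(\<integral>\<^sup>+ z. indicator (gball \<gamma> r) z *
            ennreal (gauge \<gamma> z powr \<alpha> * (grushin \<gamma> \<phi> z)\<^sup>2 / grad_gauge_sq \<gamma> z) \<partial>lborel)
    \<ge> ennreal ((Q - \<alpha>)\<^sup>2 / 4) *
          (\<integral>\<^sup>+ z. indicator (gball \<gamma> r) z *
            ennreal (gauge \<gamma> z powr \<alpha> * grad_sq \<gamma> \<phi> z / (gauge \<gamma> z)\<^sup>2) \<partial>lborel)
      + ennreal ((Q - \<alpha>) * (Q + 3*\<alpha> - 8) / 16) *
          (\<integral>\<^sup>+ z. indicator (gball \<gamma> r) z *
            ennreal (gauge \<gamma> z powr (\<alpha> - 4) * grad_gauge_sq \<gamma> z * (\<phi> z)\<^sup>2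
                     / (ln (r / gauge \<gamma> z))\<^sup>2) \<partial>lborel)"
proof -
  interpret grushin_bump \<gamma> \<alpha> r Q \<phi>
    by standard (use assms in simp_all)
  show ?thesis by (rule rellich_log) fact
qed

end
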